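(* The branch-and-cut algorithm described in the context terminates in a finite number of iterations, and upon termination the set $\mathcal{S}$ that it has built contains all the solutions of $(B_E)$ (that is, all elements of $\mathcal{X}_E\cap\mathcal{X}_{E'}$), if such solutions exist.
   Context: **Problems.** $\mathcal{X}=\{x\in\mathbb{R}^n: Ax\le b,\ x\ge0\}$, with $A$ an $m\times n$ matrix and $b$ an $m$-vector, is a nonempty (bounded) convex polytope, and $\mathcal{D}=\mathcal{X}\cap\mathbb{Z}^n\neq\emptyset$. Let $k\ge2$. - $(MOILFP)$: maximize $Z_i(x)=\dfrac{c^ix+c^i_0}{d^ix+d^i_0}$, $i=1,\dots,k$, over $x\in\mathcal{D}$. - $(BOILFP)$: maximize $f_s(x)=\dfrac{p^sx+\alpha^s}{q^sx+\beta^s}$, $s=1,2$, over $x\in\mathcal{D}$. Here $c^i,d^i,p^s,q^s$ are $n$-vectors and $c^i_0,d^i_0,\alpha^s,\beta^s$ are scalars; all denominators $d^ix+d^i_0$ and $q^sx+\beta^s$ are assumed positive on $\mathcal{X}$. A point $x\in\mathcal{D}$ is efficient for a list of objective functions on $\mathcal{D}$ if no $y\in\mathcal{D}$ is at least as good (large) in every objective and strictly better in at least one. $\mathcal{X}_E$ is the set of efficient solutions of $(MOILFP)$ and $\mathcal{X}_{E'}$ the set of efficient solutions of $(BOILFP)$. The problem $(B_E)$ is to optimize $f_1,f_2$ over $\mathcal{X}_E$; its solutions are the points efficient for both problems, i.e. the elements of $\mathcal{X}_E\cap\mathcal{X}_{E'}$. **Algorithm.** Initialize with a single root node $l=0$,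 $\mathcal{X}_0=\mathcal{X}$, $\mathcal{S}=\emptyset$. While there is a non-fathomed node left to treat, choose such a node $l$ (in any order, e.g. depth first) and solve by a simplex-type method $(LFP_l)$: $\max f_1(x)$ s.t. $x\in\mathcal{X}_l$. 1. If $(LFP_l)$ is infeasible, fathom $l$ (no descendants). 2. If the optimal solution $x^{*(l)}$ is not integer, choose $r$ with $x_r^{*(l)}$ fractional and replace $l$ by two descendants with domains $\{x\in\mathcal{X}_l:x_r\le\lfloor x_r^{*(l)}\rfloor\}$ and $\{x\in\mathcal{X}_l:x_r\ge\lceil x_r^{*(l)}\rceil\}$. 3. If $x^{*(l)}$ is integer, update $\mathcal{S}$: add $x^{*(l)}$ to $\mathcal{S}$ if both of the following programs have optimal value $0$: $$\max\sum_{i=1}^kw_i\ \text{ s.t. }\ (c^i-Z_i(x^{*(l)})d^i)x-w_i=Z_i(x^{*(l)})d^i_0-c^i_0,\ w_i\ge0\ (i=1,\dots,k),\ x\in\mathcal{D};$$ $$\max\ v_1+v_2\ \text{ s.t. }\ (p^s-f_s(x^{*(l)})q^s)x-v_s=f_s(x^{*(l)})\beta^s-\alpha^s,\ v_s\ge0\ (s=1,2),\ x\in\mathcal{D}.$$ Then construct the sets $\mathcal{H}_l,\mathcal{H}'_l$ defined below. If $\mathcal{H}_l=\emptyset$ or $\mathcal{H}'_l=\emptyset$, fathom $l$. Otherwise replace $l$ by one successor with domain $\{x\in\mathcal{X}_l:\sum_{j\in\mathcal{H}_l}x_j\ge1,\ \sum_{j\in\mathcal{H}'_l}x_j\ge1\}$.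 "Integer" means that the $n$ original variables are integers. **Simplex notation.** The domain $\mathcal{X}_l$ is written in standard equality form by adding a nonnegative slack or surplus variable for each constraint (the original constraints, the branching constraints, and the cuts added at ancestors of $l$). The indexed variables $x_j$ include these slack and surplus variables, so the cuts may involve them, and for a point of $\mathcal{X}_l$ they denote the corresponding slack or surplus values. Below, $A$ denotes the constraint matrix of this equality system and the objective vectors are extended by zeros. $\mathcal{B}_l$ denotes an optimal basis (both the basis index set and the basis matrix) of $(LFP_l)$ with basic solution $x^{*(l)}$, and $\mathcal{N}_l$ is the set of non-basic indices. For a vector $v$, $v_{\mathcal{B}_l}$ is its subvector of basic components. Put $$\nu^{s(l)}=p^s-p^s_{\mathcal{B}_l}\mathcal{B}_l^{-1}A,\quad \mu^{s(l)}=q^s-q^s_{\mathcal{B}_l}\mathcal{B}_l^{-1}A\ (s=1,2),\qquad \eta^{i(l)}=c^i-c^i_{\mathcal{B}_l}\mathcal{B}_l^{-1}A,\quad \vartheta^{i(l)}=d^i-d^i_{\mathcal{B}_l}\mathcal{B}_l^{-1}A\ (i=1,\dots,k),$$ and define the reduced gradients $$\gamma^{s(l)}=(q^sx^{*(l)}+\beta^s)\,\nu^{s(l)}-(p^sx^{*(l)}+\alpha^s)\,\mu^{s(l)}\ (s=1,2),\qquad \lambda^{i(l)}=(d^ix^{*(l)}+d^i_0)\,\eta^{i(l)}-(c^ix^{*(l)}+c^i_0)\,\vartheta^{i(l)}\ (i=1,\dots,k).$$ Optimality of the basis (the simplex table is optimal for $(LFP_l)$) means $\gamma^{1(l)}_j\le0$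 for all $j\in\mathcal{N}_l$. Finally $$\mathcal{H}_l=\{j\in\mathcal{N}_l:\exists i\in\{1,\dots,k\},\ \lambda^{i(l)}_j>0\}\cup\{j\in\mathcal{N}_l:\lambda^{i(l)}_j=0\ \forall i\in\{1,\dots,k\}\},$$ $$\mathcal{H}'_l=\{j\in\mathcal{N}_l:\gamma^{2(l)}_j>0\}\cup\{j\in\mathcal{N}_l:\gamma^{2(l)}_j=0\text{ and }\gamma^{1(l)}_j=0\}.$$
   Formalization: The claim that S contains all solutions is proved assuming the original slacks b − Ax are integers at every x in D (e.g. A, b integer); without this it fails, e.g. X={x≥0: 0.4x≤0.4}, f_1=Z_1=x, f_2=Z_2=−x. Termination holds for all real data. *)

theory Defs
  imports "HOL-Analysis.Analysis" "HOL-Library.Multiset"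
begin

section \<open>Linear fractional objectives, feasible sets, efficiency\<close>

text \<open>The function \<open>x \<mapsto> (num x + num0) / (den x + den0)\<close>.\<close>

datatype 'n linfrac =
  LinFrac (num: "real ^ 'n") (num0: real) (den: "real ^ 'n") (den0: real)

definition numer :: "'n::finite linfrac \<Rightarrow> real ^ 'n \<Rightarrow> real" where
  "numer F x = num F \<bullet> x + num0 F"

definition denom :: "'n::finite linfrac \<Rightarrow> real ^ 'n \<Rightarrow> real" where
  "denom F x = den F \<bullet> x + den0 F"

definition val :: "'n::finite linfrac \<Rightarrow> real ^ 'n \<Rightarrow> real" where
  "val F x = numer F x / denom F x"

definition polyh :: "real ^ 'n ^ 'm \<Rightarrow> real ^ 'm \<Rightarrow> (real ^ 'n) set" where
  "polyh A b = {x. (\<forall>i. (A *v x) $ i \<le> b $ i) \<and> (\<forall>j. 0 \<le> x $ j)}"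

definition integer_point :: "real ^ 'n \<Rightarrow> bool" where
  "integer_point x \<longleftrightarrow> (\<forall>j. x $ j \<in> \<int>)"

definition int_points :: "real ^ 'n ^ 'm \<Rightarrow> real ^ 'm \<Rightarrow> (real ^ 'n) set" where
  "int_points A b = {x \<in> polyh A b. integer_point x}"

definition efficient :: "(real ^ 'n) set \<Rightarrow> ('k \<Rightarrow> 'n::finite linfrac) \<Rightarrow> (real ^ 'n) set" where
  "efficient D Z = {x \<in> D. \<not> (\<exists>y\<in>D. (\<forall>i. val (Z i) x \<le> val (Z i) y)
                                 \<and> (\<exists>i. val (Z i) x < val (Z i) y))}"


section \<open>The equality form of a node\<close>

text \<open>
  A node is the list of constraints (branching constraints and cuts) added to the original system
  on the way from the root. The rows of the equality form are the given rows and the added ones;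
  row \<open>r\<close> has its own slack or surplus variable \<open>Slack r\<close>. A constraint \<open>Le a \<beta>\<close> stands for
  \<open>\<Sum>v. a v * x v \<le> \<beta>\<close> and \<open>Ge a \<beta>\<close> for \<open>\<Sum>v. a v * x v \<ge> \<beta>\<close>; the coefficients \<open>a\<close> may be
  nonzero on slack and surplus variables of earlier rows.
\<close>

datatype 'm row = Given 'm | Added nat

datatype ('n, 'm) var = Orig 'n | Slack "'m row"

datatype ('n, 'm) constr =
    Le (lhs: "('n, 'm) var \<Rightarrow> real") (rhs: real)
  | Ge (lhs: "('n, 'm) var \<Rightarrow> real") (rhs: real)

type_synonym ('n, 'm) node = "('n, 'm) constr list"

definition rows :: "('n, 'm) node \<Rightarrow> 'm row set" where
  "rows cs = range Given \<union> Added ` {..<length cs}"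

definition vars :: "('n, 'm) node \<Rightarrow> ('n, 'm) var set" where
  "vars cs = range Orig \<union> Slack ` rows cs"

fun slack_sign :: "('n, 'm) constr \<Rightarrow> real" where
  "slack_sign (Le a \<beta>) = 1"
| "slack_sign (Ge a \<beta>) = - 1"

fun std_mat :: "real ^ 'n ^ 'm \<Rightarrow> ('n, 'm) node \<Rightarrow> 'm row \<Rightarrow> ('n, 'm) var \<Rightarrow> real" where
  "std_mat A cs (Given i) (Orig j) = A $ i $ j"
| "std_mat A cs (Given i) (Slack r) = (if r = Given i then 1 else 0)"
| "std_mat A cs (Added t) v =
     (if v = Slack (Added t) then slack_sign (cs ! t) else lhs (cs ! t) v)"

fun std_rhs :: "real ^ 'm \<Rightarrow> ('n, 'm) node \<Rightarrow> 'm row \<Rightarrow> real" where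
  "std_rhs b cs (Given i) = b $ i"
| "std_rhs b cs (Added t) = rhs (cs ! t)"

definition orig_part :: "(('n, 'm) var \<Rightarrow> real) \<Rightarrow> real ^ 'n" where
  "orig_part z = (\<chi> j. z (Orig j))"

definition std_feasible ::
  "real ^ 'n ^ 'm::finite \<Rightarrow> real ^ 'm \<Rightarrow> ('n::finite, 'm) node \<Rightarrow> (('n, 'm) var \<Rightarrow> real) \<Rightarrow> bool" where
  "std_feasible A b cs z \<longleftrightarrow>
     (\<forall>v\<in>vars cs. 0 \<le> z v) \<and>
     (\<forall>r\<in>rows cs. (\<Sum>v\<in>vars cs. std_mat A cs r v * z v) = std_rhs b cs r)"

definition node_dom ::
  "real ^ 'n ^ 'm::finite \<Rightarrow> real ^ 'm \<Rightarrow> ('n::finite, 'm) node \<Rightarrow> (real ^ 'n) set" where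
  "node_dom A b cs = orig_part ` {z. std_feasible A b cs z}"


section \<open>Bases and reduced gradients\<close>

definition inverse_on ::
  "real ^ 'n ^ 'm::finite \<Rightarrow> ('n::finite, 'm) node \<Rightarrow> ('n, 'm) var set
     \<Rightarrow> (('n, 'm) var \<Rightarrow> 'm row \<Rightarrow> real) \<Rightarrow> bool" where
  "inverse_on A cs B W \<longleftrightarrow>
     (\<forall>i\<in>rows cs. \<forall>i'\<in>rows cs. (\<Sum>j\<in>B. std_mat A cs i j * W j i') = (if i = i' then 1 else 0)) \<and>
     (\<forall>j\<in>B. \<forall>j'\<in>B. (\<Sum>i\<in>rows cs. W j i * std_mat A cs i j') = (if j = j' then 1 else 0))"

definition is_basis ::
  "real ^ 'n ^ 'm::finite \<Rightarrow> ('n::finite, 'm) node \<Rightarrow> ('n, 'm) var set \<Rightarrow> bool" where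
  "is_basis A cs B \<longleftrightarrow> B \<subseteq> vars cs \<and> (\<exists>W. inverse_on A cs B W)"

text \<open>For a basis \<open>B\<close> this is determined on \<open>B \<times> rows cs\<close>, where alone it is used.\<close>

definition basis_inv ::
  "real ^ 'n ^ 'm::finite \<Rightarrow> ('n::finite, 'm) node \<Rightarrow> ('n, 'm) var set
     \<Rightarrow> ('n, 'm) var \<Rightarrow> 'm row \<Rightarrow> real" where
  "basis_inv A cs B = (SOME W. inverse_on A cs B W)"

definition tableau ::
  "real ^ 'n ^ 'm::finite \<Rightarrow> ('n::finite, 'm) node \<Rightarrow> ('n, 'm) var set
     \<Rightarrow> ('n, 'm) var \<Rightarrow> ('n, 'm) var \<Rightarrow> real" where
  "tableau A cs B v j = (\<Sum>r\<in>rows cs. basis_inv A cs B v r * std_mat A cs r j)"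

definition basic_sol ::
  "real ^ 'n ^ 'm::finite \<Rightarrow> real ^ 'm \<Rightarrow> ('n::finite, 'm) node \<Rightarrow> ('n, 'm) var set
     \<Rightarrow> ('n, 'm) var \<Rightarrow> real" where
  "basic_sol A b cs B v =
     (if v \<in> B then \<Sum>r\<in>rows cs. basis_inv A cs B v r * std_rhs b cs r else 0)"

definition basic_point ::
  "real ^ 'n ^ 'm::finite \<Rightarrow> real ^ 'm \<Rightarrow> ('n::finite, 'm) node \<Rightarrow> ('n, 'm) var set
     \<Rightarrow> real ^ 'n" where
  "basic_point A b cs B = orig_part (basic_sol A b cs B)"

fun extend0 :: "real ^ 'n \<Rightarrow> ('n, 'm) var \<Rightarrow> real" where
  "extend0 p (Orig j) = p $ j"
| "extend0 p (Slack r) = 0"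

definition reduced ::
  "real ^ 'n ^ 'm::finite \<Rightarrow> ('n::finite, 'm) node \<Rightarrow> ('n, 'm) var set \<Rightarrow> real ^ 'n
     \<Rightarrow> ('n, 'm) var \<Rightarrow> real" where
  "reduced A cs B p j = extend0 p j - (\<Sum>v\<in>B. extend0 p v * tableau A cs B v j)"

definition reduced_gradient ::
  "real ^ 'n ^ 'm::finite \<Rightarrow> real ^ 'm \<Rightarrow> ('n::finite, 'm) node \<Rightarrow> ('n, 'm) var set
     \<Rightarrow> 'n linfrac \<Rightarrow> ('n, 'm) var \<Rightarrow> real" where
  "reduced_gradient A b cs B F j =
     denom F (basic_point A b cs B) * reduced A cs B (num F) j
     - numer F (basic_point A b cs B) * reduced A cs B (den F) j"

definition optimal_basis ::
  "real ^ 'n ^ 'm::finite \<Rightarrow> real ^ 'm \<Rightarrow> 'n::finite linfrac \<Rightarrow> ('n, 'm) node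
     \<Rightarrow> ('n, 'm) var set \<Rightarrow> bool" where
  "optimal_basis A b F cs B \<longleftrightarrow>
     is_basis A cs B \<and> (\<forall>v\<in>B. 0 \<le> basic_sol A b cs B v) \<and>
     (\<forall>j\<in>vars cs - B. reduced_gradient A b cs B F j \<le> 0)"


section \<open>Efficiency test and cuts\<close>

definition test_values ::
  "(real ^ 'n) set \<Rightarrow> ('k::finite \<Rightarrow> 'n::finite linfrac) \<Rightarrow> real ^ 'n \<Rightarrow> real set" where
  "test_values D Z x = {(\<Sum>i\<in>UNIV. w i) | w y. y \<in> D \<and> (\<forall>i. 0 \<le> w i \<and>
      (num (Z i) - val (Z i) x *\<^sub>R den (Z i)) \<bullet> y - w i
        = val (Z i) x * den0 (Z i) - num0 (Z i))}"

definition is_max_value :: "real set \<Rightarrow> real \<Rightarrow> bool" where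
  "is_max_value V v \<longleftrightarrow> v \<in> V \<and> (\<forall>u\<in>V. u \<le> v)"

definition passes_tests ::
  "(real ^ 'n) set \<Rightarrow> ('k::finite \<Rightarrow> 'n::finite linfrac) \<Rightarrow> (2 \<Rightarrow> 'n linfrac) \<Rightarrow> real ^ 'n \<Rightarrow> bool" where
  "passes_tests D Z f x \<longleftrightarrow>
     is_max_value (test_values D Z x) 0 \<and> is_max_value (test_values D f x) 0"

definition cut_set ::
  "real ^ 'n ^ 'm::finite \<Rightarrow> real ^ 'm \<Rightarrow> ('k \<Rightarrow> 'n::finite linfrac) \<Rightarrow> ('n, 'm) node
     \<Rightarrow> ('n, 'm) var set \<Rightarrow> ('n, 'm) var set" where
  "cut_set A b Z cs B =
     {j \<in> vars cs - B. \<exists>i. reduced_gradient A b cs B (Z i) j > 0} \<union>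
     {j \<in> vars cs - B. \<forall>i. reduced_gradient A b cs B (Z i) j = 0}"

text \<open>The bi-objective problem is indexed by the two-element type, in which \<open>1 \<noteq> 2\<close>.\<close>

definition cut_set' ::
  "real ^ 'n ^ 'm::finite \<Rightarrow> real ^ 'm \<Rightarrow> (2 \<Rightarrow> 'n::finite linfrac) \<Rightarrow> ('n, 'm) node
     \<Rightarrow> ('n, 'm) var set \<Rightarrow> ('n, 'm) var set" where
  "cut_set' A b f cs B =
     {j \<in> vars cs - B. reduced_gradient A b cs B (f 2) j > 0} \<union>
     {j \<in> vars cs - B. reduced_gradient A b cs B (f 2) j = 0
                       \<and> reduced_gradient A b cs B (f 1) j = 0}"

definition branch_le :: "'n \<Rightarrow> real \<Rightarrow> ('n, 'm) constr" where
  "branch_le r t = Le (\<lambda>v. if v = Orig r then 1 else 0) (of_int \<lfloor>t\<rfloor>)"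

definition branch_ge :: "'n \<Rightarrow> real \<Rightarrow> ('n, 'm) constr" where
  "branch_ge r t = Ge (\<lambda>v. if v = Orig r then 1 else 0) (of_int \<lceil>t\<rceil>)"

text \<open>
  A cut asks a sum of nonnegative variables to be at least \<open>1\<close> rather than positive. It keeps the
  integer points with a positive sum if the slack variables \<open>b - A *v x\<close> of the original
  constraints take integer values at the integer points, for instance if \<open>A\<close> and \<open>b\<close> are integer;
  for arbitrary real data it can remove efficient points.
\<close>

definition cut :: "('n, 'm) var set \<Rightarrow> ('n, 'm) constr" where
  "cut H = Ge (\<lambda>v. if v \<in> H then 1 else 0) 1"


section \<open>The branch-and-cut algorithm\<close>

text \<open>
  A state consists of the open (non-fathomed, untreated) nodes and the set \<open>S\<close>; \<open>iter\<close> is one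
  iteration. The choices of the node, of the optimal basis and of the branching variable
  are left nondeterministic, so a run of the algorithm is any chain of iterations, and it has
  terminated properly when no open node is left.
\<close>

type_synonym ('n, 'm) bc_state = "('n, 'm) node multiset \<times> (real ^ 'n) set"

definition update ::
  "(real ^ 'n) set \<Rightarrow> ('k::finite \<Rightarrow> 'n::finite linfrac) \<Rightarrow> (2 \<Rightarrow> 'n linfrac) \<Rightarrow> real ^ 'n
     \<Rightarrow> (real ^ 'n) set \<Rightarrow> (real ^ 'n) set" where
  "update D Z f x S = (if passes_tests D Z f x then insert x S else S)"

inductive iter ::
  "real ^ 'n ^ 'm::finite \<Rightarrow> real ^ 'm \<Rightarrow> ('k::finite \<Rightarrow> 'n::finite linfrac) \<Rightarrow> (2 \<Rightarrow> 'n linfrac)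
     \<Rightarrow> ('n, 'm) bc_state \<Rightarrow> ('n, 'm) bc_state \<Rightarrow> bool"
  for A b Z f where
  infeasible:
    "node_dom A b cs = {} \<Longrightarrow> iter A b Z f (add_mset cs N, S) (N, S)"
| branch:
    "\<lbrakk>optimal_basis A b (f 1) cs B; x = basic_point A b cs B; x $ r \<notin> \<int>\<rbrakk>
     \<Longrightarrow> iter A b Z f (add_mset cs N, S)
          (add_mset (cs @ [branch_le r (x $ r)]) (add_mset (cs @ [branch_ge r (x $ r)]) N), S)"
| fathom:
    "\<lbrakk>optimal_basis A b (f 1) cs B; x = basic_point A b cs B; integer_point x;
      cut_set A b Z cs B = {} \<or> cut_set' A b f cs B = {}\<rbrakk>
     \<Longrightarrow> iter A b Z f (add_mset cs N, S) (N, update (int_points A b) Z f x S)"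
| cut:
    "\<lbrakk>optimal_basis A b (f 1) cs B; x = basic_point A b cs B; integer_point x;
      cut_set A b Z cs B \<noteq> {}; cut_set' A b f cs B \<noteq> {}\<rbrakk>
     \<Longrightarrow> iter A b Z f (add_mset cs N, S)
          (add_mset (cs @ [cut (cut_set A b Z cs B), cut (cut_set' A b f cs B)]) N,
           update (int_points A b) Z f x S)"

definition init_state :: "('n, 'm) bc_state" where
  "init_state = ({#[]#}, {})"

end

theory Submission
  imports Defs "HOL-Computational_Algebra.Polynomial"
begin

text \<open>
  Termination rests on two finite reserves of a node. A pair of a coordinate and a unit interval of
  consecutive integers is straddled if some point of the node domain has that coordinate strictly
  inside the interval; boundedness leaves finitely many straddled pairs and finitely many integer
  points. Branching at a fractional coordinate destroys the straddled pair it branches on, in both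
  descendants. A pair of cuts removes the integer point \<open>x*\<close> it was computed from, since the cuts
  are sums of variables that are non-basic, hence zero, at \<open>x*\<close>, while the slack values of a point
  are determined by its original coordinates. So each iteration replaces one open node by at most
  two nodes with a smaller number of reserves (\<open>node_measure_branch\<close>, \<open>node_measure_cut\<close>), which
  is well-founded in the multiset order (\<open>no_infinite_run\<close>).

  An open node can always be treated because a nonempty node domain has an optimal basis. For a
  linear objective this is \<open>linear_system.optimal_basis_exists\<close>: after a generic perturbation of the
  right-hand side no basic solution is degenerate, a best feasible basis then has no improving edge,
  and if the perturbation is small enough this basis is feasible for the unperturbed system. A linear
  fractional objective with best basic value \<open>t\<close> is reduced to the linear one
  \<open>numerator - t * denominator\<close> (\<open>linfrac_optimal_basis_exists\<close>).

  For completeness, fix a point \<open>x\<close> that is efficient for both problems. It is kept alive: it is in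
  \<open>S\<close> or in the domain of an open node. Branching keeps it because it is an integer point. At an
  integer optimum \<open>x*\<close> different from \<open>x\<close>, the sign of \<open>val F x - val F x*\<close> is that of
  \<open>\<Sum>j. \<gamma> j * z j\<close>, taken over the non-basic variables, with \<open>\<gamma>\<close> the reduced gradient of \<open>F\<close> and
  \<open>z\<close> the values at \<open>x\<close> (\<open>cross_difference\<close>). If all \<open>z j\<close> with \<open>j\<close> in a cut set vanished,
  the remaining columns would make \<open>x*\<close> at least as good as \<open>x\<close> in every objective, strictly in one
  (\<open>efficient_meets_cut\<close>); so some such \<open>z j\<close> is positive, and at least \<open>1\<close> because all
  variables take integer values at \<open>x\<close> once the slack variables of the given rows do. At \<open>x* = x\<close> both tests succeed and \<open>x\<close> enters \<open>S\<close>.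
\<close>

section \<open>Bases of a system of linear equations\<close>

text \<open>
  Among the coordinates that decrease along \<open>t\<close>, the one with the least quotient reaches zero first;
  stopping there keeps all coordinates nonnegative.
\<close>

lemma ratio_test:
  fixes y t :: "'v \<Rightarrow> real"
  assumes "finite B" and nonneg: "\<forall>v\<in>B. 0 \<le> y v" and "\<exists>v\<in>B. t v < 0"
  obtains u where "u \<in> B" "t u < 0" "\<forall>v\<in>B. 0 \<le> y v + (y u / - t u) * t v"
proof -
  define K where "K = {v\<in>B. t v < 0}"
  define q where "q v = y v / - t v" for v
  have K: "finite (q ` K)" "q ` K \<noteq> {}"
    using assms by (auto simp: K_def)
  obtain u where u: "u \<in> K" "q u = Min (q ` K)"
    using Min_in[OF K] by (metis imageE)
  have "0 \<le> y v + q u * t v" if "v \<in> B" for v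
  proof (cases "t v < 0")
    case True
    then have "q u \<le> q v"
      using u K that by (auto simp: K_def)
    then have "q u * (- t v) \<le> y v"
      using True by (simp add: q_def field_simps)
    then show ?thesis by simp
  next
    case False
    moreover have "0 \<le> q u"
      using u(1) nonneg unfolding q_def K_def by (intro divide_nonneg_pos) auto
    ultimately show ?thesis
      using nonneg that by simp
  qed
  then show thesis
    using that[of u] u by (simp add: q_def K_def)
qed

text \<open>
  A nonzero polynomial has finitely many roots. This rules out degeneracy for small perturbations,
  under which the coordinates of basic solutions are polynomials in the perturbation parameter.
\<close>

lemma eventually_poly_nonzero_at_right:
  fixes p :: "real poly"
  assumes "p \<noteq> 0"
  shows "eventually (\<lambda>s. poly p s \<noteq> 0) (at_right a)"
proof -
  have "finite {s. poly p s = 0}"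
    using assms by (rule poly_roots_finite)
  then have "open (- ({s. poly p s = 0} - {a}))"
    by (intro open_Compl finite_imp_closed) auto
  then have "eventually (\<lambda>s. s \<in> - ({s. poly p s = 0} - {a})) (nhds a)"
    by (rule eventually_nhds_in_open) simp
  then show ?thesis
    by (auto simp: eventually_at_filter elim: eventually_mono)
qed

locale linear_system =
  fixes R :: "'r set" and V :: "'v set" and M :: "'r \<Rightarrow> 'v \<Rightarrow> real"
  assumes finite_R: "finite R" and finite_V: "finite V"
begin

definition solves :: "('r \<Rightarrow> real) \<Rightarrow> ('v \<Rightarrow> real) \<Rightarrow> bool" where
  "solves \<beta> z \<longleftrightarrow> (\<forall>r\<in>R. (\<Sum>v\<in>V. M r v * z v) = \<beta> r)"

text \<open>
  A basis is a column set \<open>B\<close> together with a two-sided inverse \<open>W\<close> of the submatrix \<open>R \<times> B\<close>;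
  carrying \<open>W\<close> along makes rank arguments unnecessary.
\<close>

definition basis :: "'v set \<Rightarrow> ('v \<Rightarrow> 'r \<Rightarrow> real) \<Rightarrow> bool" where
  "basis B W \<longleftrightarrow> B \<subseteq> V \<and>
     (\<forall>i\<in>R. \<forall>i'\<in>R. (\<Sum>j\<in>B. M i j * W j i') = (if i = i' then 1 else 0)) \<and>
     (\<forall>j\<in>B. \<forall>j'\<in>B. (\<Sum>i\<in>R. W j i * M i j') = (if j = j' then 1 else 0))"

definition sol :: "('v \<Rightarrow> 'r \<Rightarrow> real) \<Rightarrow> ('r \<Rightarrow> real) \<Rightarrow> 'v \<Rightarrow> real" where
  "sol W \<beta> v = (\<Sum>r\<in>R. W v r * \<beta> r)"

text \<open>
  A column of the simplex tableau is the basic solution for a column of \<open>M\<close> as right-hand side.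
\<close>

abbreviation tab :: "('v \<Rightarrow> 'r \<Rightarrow> real) \<Rightarrow> 'v \<Rightarrow> 'v \<Rightarrow> real" where
  "tab W v j \<equiv> sol W (\<lambda>r. M r j) v"

lemma basis_subset: "basis B W \<Longrightarrow> B \<subseteq> V"
  and basis_finite: "basis B W \<Longrightarrow> finite B"
  unfolding basis_def using finite_V finite_subset by blast+

lemma tab_basic:
  "basis B W \<Longrightarrow> v \<in> B \<Longrightarrow> u \<in> B \<Longrightarrow> tab W v u = (if v = u then 1 else 0)"
  unfolding basis_def sol_def by blast

lemma sum_basic_sol:
  assumes "basis B W" "r \<in> R"
  shows "(\<Sum>v\<in>B. M r v * sol W \<beta> v) = \<beta> r"
proof -
  have "(\<Sum>v\<in>B. M r v * sol W \<beta> v) = (\<Sum>r'\<in>R. (\<Sum>v\<in>B. M r v * W v r') * \<beta> r')"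
    unfolding sol_def sum_distrib_left sum_distrib_right
    by (subst sum.swap) (simp add: mult.assoc)
  also have "\<dots> = (\<Sum>r'\<in>R. if r = r' then \<beta> r' else 0)"
    using assms by (intro sum.cong) (auto simp: basis_def)
  finally show ?thesis
    using assms finite_R by simp
qed

lemma sol_of_columns:
  assumes "\<And>r. r \<in> R \<Longrightarrow> \<beta> r = \<beta>0 r + (\<Sum>u\<in>U. M r u * z u)"
  shows "sol W \<beta> v = sol W \<beta>0 v + (\<Sum>u\<in>U. tab W v u * z u)"
proof -
  have "sol W \<beta> v = (\<Sum>r\<in>R. W v r * \<beta>0 r + (\<Sum>u\<in>U. W v r * M r u * z u))"
    unfolding sol_def using assms
    by (intro sum.cong) (auto simp: algebra_simps sum_distrib_left)
  also have "\<dots> = sol W \<beta>0 v + (\<Sum>r\<in>R. \<Sum>u\<in>U. W v r * M r u * z u)"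
    by (simp add: sum.distrib sol_def)
  also have "(\<Sum>r\<in>R. \<Sum>u\<in>U. W v r * M r u * z u) = (\<Sum>u\<in>U. tab W v u * z u)"
    by (subst sum.swap) (simp add: sol_def sum_distrib_right)
  finally show ?thesis .
qed

text \<open>
  Expand the right-hand side in the columns of \<open>M\<close> with coefficients \<open>z\<close>; the basic columns
  contribute unit vectors. All later use of bases goes through this row of the dictionary.
\<close>

lemma dictionary:
  assumes B: "basis B W" and z: "solves \<beta> z" and v: "v \<in> B"
  shows "z v = sol W \<beta> v - (\<Sum>j\<in>V - B. tab W v j * z j)"
proof -
  have "sol W \<beta> v = sol W (\<lambda>_. 0) v + (\<Sum>u\<in>V. tab W v u * z u)"
    using z by (intro sol_of_columns) (simp add: solves_def)
  then have "sol W \<beta> v = (\<Sum>u\<in>V. tab W v u * z u)"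
    by (simp add: sol_def[of W "\<lambda>_. 0"])
  also have "\<dots> = (\<Sum>u\<in>B. tab W v u * z u) + (\<Sum>j\<in>V - B. tab W v j * z j)"
    using sum.subset_diff[OF basis_subset[OF B] finite_V] by (simp only: add.commute)
  also have "(\<Sum>u\<in>B. tab W v u * z u) = (\<Sum>u\<in>B. if v = u then z u else 0)"
    using tab_basic[OF B v] by (intro sum.cong) simp_all
  finally show ?thesis
    using v basis_finite[OF B] by simp
qed

corollary basic_solution_unique:
  assumes "basis B W" "solves \<beta> z" "v \<in> B" "\<And>j. j \<in> V - B \<Longrightarrow> z j = 0"
  shows "z v = sol W \<beta> v"
  using dictionary[OF assms(1-3)] assms(4) by simp

text \<open>
  Column \<open>i\<close> of an inverse is the basic solution for the \<open>i\<close>-th unit vector, and basic solutions do not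
  depend on the inverse.
\<close>

lemma basis_unique:
  assumes B: "basis B W" "basis B W'" and v: "v \<in> B" "i \<in> R"
  shows "W v i = W' v i"
proof -
  define \<beta> where "\<beta> r = (if r = i then 1 else 0::real)" for r
  have W: "sol W'' \<beta> u = W'' u i" for W'' u
    using finite_R v by (simp add: sol_def \<beta>_def if_distrib[of "\<lambda>x. _ * x"] cong: if_cong)
  define z where "z u = (if u \<in> B then sol W' \<beta> u else 0)" for u
  have "solves \<beta> z"
    unfolding solves_def
  proof
    fix r assume "r \<in> R"
    have "(\<Sum>u\<in>V. M r u * z u) = (\<Sum>u\<in>B. M r u * sol W' \<beta> u)"
      using basis_subset[OF B(1)] finite_V
      by (intro sum.mono_neutral_cong_right) (auto simp: z_def)
    then show "(\<Sum>u\<in>V. M r u * z u) = \<beta> r"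
      using sum_basic_sol[OF B(2) \<open>r \<in> R\<close>] by simp
  qed
  from basic_solution_unique[OF B(1) this v(1)] show ?thesis
    using v by (simp add: z_def W)
qed

corollary sol_unique:
  assumes "basis B W" "basis B W'" "v \<in> B"
  shows "sol W \<beta> v = sol W' \<beta> v"
  unfolding sol_def using basis_unique[OF assms] by (intro sum.cong) auto

text \<open>
  The direction in which the solution moves when the non-basic variable \<open>j\<close> increases at unit speed
  and the other non-basic variables stay fixed.
\<close>

definition edge :: "'v set \<Rightarrow> ('v \<Rightarrow> 'r \<Rightarrow> real) \<Rightarrow> 'v \<Rightarrow> 'v \<Rightarrow> real" where
  "edge B W j v = (if v = j then 1 else if v \<in> B then - tab W v j else 0)"

lemma sum_edge:
  assumes B: "basis B W" and j: "j \<in> V - B"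
  shows "(\<Sum>v\<in>V. g v * edge B W j v) = g j - (\<Sum>v\<in>B. g v * tab W v j)"
proof -
  have "(\<Sum>v\<in>V. g v * edge B W j v) = (\<Sum>v\<in>insert j B. g v * edge B W j v)"
    using basis_subset[OF B] finite_V j
    by (intro sum.mono_neutral_right) (auto simp: edge_def)
  also have "\<dots> = g j + (\<Sum>v\<in>B. g v * edge B W j v)"
    using j basis_finite[OF B] by (simp add: edge_def)
  also have "(\<Sum>v\<in>B. g v * edge B W j v) = (\<Sum>v\<in>B. - (g v * tab W v j))"
    using j by (intro sum.cong) (auto simp: edge_def)
  finally show ?thesis
    by (simp add: sum_negf)
qed

lemma solves_edge: "basis B W \<Longrightarrow> j \<in> V - B \<Longrightarrow> solves (\<lambda>_. 0) (edge B W j)"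
  by (simp add: solves_def sum_edge sum_basic_sol)

lemma solves_add:
  "solves \<beta> z \<Longrightarrow> solves \<beta>' d \<Longrightarrow> solves (\<lambda>r. \<beta> r + \<theta> * \<beta>' r) (\<lambda>v. z v + \<theta> * d v)"
  unfolding solves_def
  by (simp add: distrib_left sum.distrib mult.left_commute[of _ \<theta>] flip: sum_distrib_left)

lemma solves_add_edge:
  "basis B W \<Longrightarrow> j \<in> V - B \<Longrightarrow> solves \<beta> z \<Longrightarrow> solves \<beta> (\<lambda>v. z v + \<theta> * edge B W j v)"
  using solves_add[OF _ solves_edge] by simp

text \<open>
  The inverse for the new basis arises from \<open>W\<close> by one Gauss--Jordan step on the pivot entry.
\<close>

lemma pivot:
  assumes B: "basis B W" and u: "u \<in> B" and j: "j \<in> V - B" and nz: "tab W u j \<noteq> 0"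
  shows "\<exists>W'. basis (insert j (B - {u})) W'"
proof -
  define T where "T = tab W u j"
  define W' where "W' v r = (if v = j then W u r / T else W v r - tab W v j / T * W u r)" for v r
  have fin: "finite B" using B by (rule basis_finite)
  have T: "T \<noteq> 0" using nz by (simp add: T_def)
  have right: "(\<Sum>v\<in>insert j (B - {u}). M i v * W' v i') = (if i = i' then 1 else 0)"
    if i: "i \<in> R" "i' \<in> R" for i i'
  proof -
    have "(\<Sum>v\<in>B - {u}. M i v * W' v i')
        = (\<Sum>v\<in>B - {u}. M i v * W v i' - W u i' / T * (M i v * tab W v j))"
      using j by (intro sum.cong) (auto simp: W'_def algebra_simps)
    also have "\<dots> = (\<Sum>v\<in>B - {u}. M i v * W v i') - W u i' / T * (\<Sum>v\<in>B - {u}. M i v * tab W v j)"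
      unfolding sum_subtractf sum_distrib_left ..
    also have "(\<Sum>v\<in>B - {u}. M i v * W v i') = (if i = i' then 1 else 0) - M i u * W u i'"
      using B i u fin by (simp add: basis_def sum_diff1)
    also have "(\<Sum>v\<in>B - {u}. M i v * tab W v j) = M i j - M i u * T"
      using u fin sum_basic_sol[OF B i(1)] by (simp add: sum_diff1 T_def)
    finally show ?thesis
      using fin j T by (simp add: W'_def field_simps)
  qed
  have left: "(\<Sum>i\<in>R. W' v i * M i v') = (if v = v' then 1 else 0)"
    if v: "v \<in> insert j (B - {u})" "v' \<in> insert j (B - {u})" for v v'
  proof (cases "v = j")
    case True
    have "(\<Sum>i\<in>R. W' v i * M i v') = tab W u v' / T"
      using True by (simp add: W'_def sol_def sum_divide_distrib)
    then show ?thesis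
      using True v T u j tab_basic[OF B u, of v'] by (auto simp: T_def)
  next
    case False
    have "(\<Sum>i\<in>R. W' v i * M i v') = (\<Sum>i\<in>R. W v i * M i v' - tab W v j / T * (W u i * M i v'))"
      using False by (simp add: W'_def algebra_simps)
    also have "\<dots> = tab W v v' - tab W v j / T * tab W u v'"
      by (simp only: sum_subtractf sum_distrib_left[symmetric]) (simp add: sol_def)
    finally show ?thesis
      using False v T u j tab_basic[OF B u, of v'] tab_basic[OF B, of v v']
      by (auto simp: T_def[symmetric])
  qed
  have "basis (insert j (B - {u})) W'"
    using right left basis_subset[OF B] j unfolding basis_def by blast
  then show ?thesis by blast
qed

section \<open>Feasible bases\<close>

definition feasible :: "('r \<Rightarrow> real) \<Rightarrow> ('v \<Rightarrow> real) \<Rightarrow> bool" where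
  "feasible \<beta> z \<longleftrightarrow> (\<forall>v\<in>V. 0 \<le> z v) \<and> solves \<beta> z"

text \<open>
  Induction on the number of nonzero non-basic variables of a feasible point. Such a variable is
  decreased along its edge: either it reaches zero, or a basic variable does so first and the two are
  exchanged. In both cases the number drops, and at number zero the point is the basic solution.
\<close>

lemma feasible_basis_exists:
  assumes "basis B W" "feasible \<beta> z"
  shows "\<exists>B W. basis B W \<and> (\<forall>v\<in>B. 0 \<le> sol W \<beta> v)"
  using assms
proof (induction "card {v \<in> V - B. z v \<noteq> 0}" arbitrary: B W z rule: less_induct)
  case less
  note B = \<open>basis B W\<close>
  have z: "solves \<beta> z" "\<And>v. v \<in> V \<Longrightarrow> 0 \<le> z v"
    using less.prems by (auto simp: feasible_def)
  have BV: "B \<subseteq> V" "finite B"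
    using B basis_subset basis_finite by auto
  show ?case
  proof (cases "\<exists>j\<in>V - B. z j \<noteq> 0")
    case False
    then have "z v = sol W \<beta> v" if "v \<in> B" for v
      using basic_solution_unique[OF B z(1) that] by blast
    then have "\<forall>v\<in>B. 0 \<le> sol W \<beta> v"
      using z(2) BV by (metis subsetD)
    then show ?thesis using B by blast
  next
    case True
    then obtain j where j: "j \<in> V - B" "z j \<noteq> 0" by blast
    \<comment> \<open>The point reached after decreasing variable \<open>j\<close> by \<open>\<theta>\<close>.\<close>
    define z' where "z' \<theta> v = z v + (- \<theta>) * edge B W j v" for \<theta> v
    have z'_j: "z' \<theta> j = z j - \<theta>" for \<theta>
      by (simp add: z'_def edge_def)
    have z'_B: "z' \<theta> v = z v + \<theta> * tab W v j" if "v \<in> B" for \<theta> v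
      using that j by (auto simp: z'_def edge_def)
    have z'_N: "z' \<theta> v = z v" if "v \<in> V - B - {j}" for \<theta> v
      using that by (auto simp: z'_def edge_def)
    have feas: "feasible \<beta> (z' \<theta>)"
      if "\<theta> \<le> z j" "\<forall>v\<in>B. 0 \<le> z v + \<theta> * tab W v j" for \<theta>
    proof -
      have "solves \<beta> (z' \<theta>)"
        unfolding z'_def using solves_add_edge[OF B j(1) z(1)] .
      moreover have "0 \<le> z' \<theta> v" if "v \<in> V" for v
      proof (cases "v = j")
        case True
        then show ?thesis using \<open>\<theta> \<le> z j\<close> z'_j[of \<theta>] by simp
      next
        case False
        with that z(2) \<open>\<forall>v\<in>B. _ v\<close> show ?thesis
          by (cases "v \<in> B") (auto simp: z'_B z'_N)
      qed
      ultimately show ?thesis by (simp add: feasible_def)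
    qed
    show ?thesis
    proof (cases "\<forall>v\<in>B. 0 \<le> z v + z j * tab W v j")
      case True
      have "{v \<in> V - B. z' (z j) v \<noteq> 0} \<subset> {v \<in> V - B. z v \<noteq> 0}"
        using j z'_j[of "z j"] z'_N[of _ "z j"] by force
      then have "card {v \<in> V - B. z' (z j) v \<noteq> 0} < card {v \<in> V - B. z v \<noteq> 0}"
        using finite_V by (intro psubset_card_mono) auto
      from less.hyps[OF this B feas[OF _ True]] show ?thesis by simp
    next
      case False
      then obtain w where w: "w \<in> B" "z w + z j * tab W w j < 0" by force
      have "0 \<le> z w" "0 \<le> z j"
        using z(2) w BV j by auto
      then have "tab W w j < 0"
        using w by (smt (verit) mult_nonneg_nonneg)
      then obtain u where u: "u \<in> B" "tab W u j < 0"
        "\<forall>v\<in>B. 0 \<le> z v + (z u / - tab W u j) * tab W v j"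
        using ratio_test[of B z "\<lambda>v. tab W v j"] w z(2) BV by blast
      define \<theta> where "\<theta> = z u / - tab W u j"
      have "\<theta> \<le> z j"
      proof (rule ccontr)
        assume "\<not> \<theta> \<le> z j"
        then have "\<theta> * tab W w j \<le> z j * tab W w j"
          using \<open>tab W w j < 0\<close> by (simp add: mult_right_mono_neg)
        moreover have "0 \<le> z w + \<theta> * tab W w j"
          using u w by (simp add: \<theta>_def)
        ultimately show False using w by simp
      qed
      have zu: "z' \<theta> u = 0"
        using z'_B[OF u(1), of \<theta>] u(2) by (simp add: \<theta>_def field_simps)
      obtain W' where W': "basis (insert j (B - {u})) W'"
        using pivot[OF B u(1) j(1)] u(2) by auto
      have "{v \<in> V - insert j (B - {u}). z' \<theta> v \<noteq> 0} \<subset> {v \<in> V - B. z v \<noteq> 0}"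
        using j zu z'_N[of _ \<theta>] by force
      then have "card {v \<in> V - insert j (B - {u}). z' \<theta> v \<noteq> 0} < card {v \<in> V - B. z v \<noteq> 0}"
        using finite_V by (intro psubset_card_mono) auto
      from less.hyps[OF this W' feas] show ?thesis
        using \<open>\<theta> \<le> z j\<close> u(3) by (simp add: \<theta>_def)
    qed
  qed
qed

section \<open>Optimal bases of linear programs\<close>

definition basic :: "('v \<Rightarrow> 'r \<Rightarrow> real) \<Rightarrow> ('r \<Rightarrow> real) \<Rightarrow> 'v set \<Rightarrow> 'v \<Rightarrow> real" where
  "basic W \<beta> B v = (if v \<in> B then sol W \<beta> v else 0)"

lemma sum_basic:
  assumes B: "basis B W"
  shows "(\<Sum>v\<in>V. g v * basic W \<beta> B v) = (\<Sum>v\<in>B. g v * sol W \<beta> v)"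
  using basis_subset[OF B] finite_V
  by (intro sum.mono_neutral_cong_right) (auto simp: basic_def)

lemma feasible_basic:
  assumes "basis B W" "\<forall>v\<in>B. 0 \<le> sol W \<beta> v"
  shows "feasible \<beta> (basic W \<beta> B)"
  using assms by (simp add: feasible_def solves_def sum_basic sum_basic_sol) (simp add: basic_def)

text \<open>
  The reduced costs of the objective \<open>c\<close>.
\<close>

definition red :: "'v set \<Rightarrow> ('v \<Rightarrow> 'r \<Rightarrow> real) \<Rightarrow> ('v \<Rightarrow> real) \<Rightarrow> 'v \<Rightarrow> real" where
  "red B W c j = c j - (\<Sum>v\<in>B. c v * tab W v j)"

lemma objective_in_nonbasic:
  assumes B: "basis B W" and z: "solves \<beta> z"
  shows "(\<Sum>v\<in>V. c v * z v) = (\<Sum>v\<in>V. c v * basic W \<beta> B v) + (\<Sum>j\<in>V - B. red B W c j * z j)"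
proof -
  have "(\<Sum>v\<in>V. c v * z v) = (\<Sum>v\<in>B. c v * z v) + (\<Sum>j\<in>V - B. c j * z j)"
    using sum.subset_diff[OF basis_subset[OF B] finite_V] by (simp only: add.commute)
  also have "(\<Sum>v\<in>B. c v * z v)
      = (\<Sum>v\<in>B. c v * sol W \<beta> v - (\<Sum>j\<in>V - B. c v * tab W v j * z j))"
    using dictionary[OF B z]
    by (intro sum.cong) (simp_all add: right_diff_distrib sum_distrib_left mult.assoc)
  also have "\<dots> = (\<Sum>v\<in>B. c v * sol W \<beta> v) - (\<Sum>j\<in>V - B. (\<Sum>v\<in>B. c v * tab W v j) * z j)"
    by (simp add: sum_subtractf sum_distrib_right) (rule sum.swap)
  finally show ?thesis
    by (simp add: red_def sum_basic[OF B] left_diff_distrib sum_subtractf)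
qed

lemma red_unique:
  assumes "basis B W" "basis B W'"
  shows "red B W c j = red B W' c j"
  unfolding red_def using sol_unique[OF assms] by simp

text \<open>
  Take a feasible basis of largest objective value. If some reduced cost were positive, its edge
  would leave the feasible set, since the only feasible ray is zero; by nondegeneracy the step up to the
  blocking variable has positive length, so the pivot would reach a better feasible basis.
\<close>

lemma optimal_basis_nondegenerate:
  assumes ex: "basis B0 W0" "feasible \<beta> z0"
    and nondeg: "\<And>B W v. basis B W \<Longrightarrow> v \<in> B \<Longrightarrow> sol W \<beta> v \<noteq> 0"
    and no_ray: "\<And>d. feasible (\<lambda>_. 0) d \<Longrightarrow> \<forall>v\<in>V. d v = 0"
  shows "\<exists>B W. basis B W \<and> (\<forall>v\<in>B. 0 \<le> sol W \<beta> v) \<and> (\<forall>j\<in>V - B. red B W c j \<le> 0)"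
proof -
  define wit where "wit B = (SOME W. basis B W)" for B
  have wit: "basis B (wit B)" if "basis B W" for B W
    unfolding wit_def using that by (rule someI[where P = "basis B"])
  define obj where "obj B = (\<Sum>v\<in>V. c v * basic (wit B) \<beta> B v)" for B
  define F where "F = {B. basis B (wit B) \<and> (\<forall>v\<in>B. 0 \<le> sol (wit B) \<beta> v)}"
  have inF: "B \<in> F" if "basis B W" "\<forall>v\<in>B. 0 \<le> sol W \<beta> v" for B W
  proof -
    have "0 \<le> sol (wit B) \<beta> v" if "v \<in> B" for v
      using sol_unique[OF \<open>basis B W\<close> wit[OF \<open>basis B W\<close>] that, of \<beta>] \<open>\<forall>v\<in>B. _ v\<close> that by metis
    then show ?thesis
      using wit[OF that(1)] by (simp add: F_def)
  qed
  have "F \<subseteq> Pow V"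
    using basis_subset by (auto simp: F_def)
  then have fin: "finite (obj ` F)"
    using finite_V by (meson finite_Pow_iff finite_imageI finite_subset)
  have "F \<noteq> {}"
    using feasible_basis_exists[OF ex] inF by blast
  then have "Max (obj ` F) \<in> obj ` F"
    using fin by (intro Max_in) auto
  then obtain B where BF: "B \<in> F" and "obj B = Max (obj ` F)"
    by force
  then have max: "obj B' \<le> obj B" if "B' \<in> F" for B'
    using that fin by simp
  define W where "W = wit B"
  have B: "basis B W" and pos: "\<And>v. v \<in> B \<Longrightarrow> 0 < sol W \<beta> v"
    using BF nondeg by (fastforce simp: F_def W_def less_le)+
  have "red B W c j \<le> 0" if j: "j \<in> V - B" for j
  proof (rule ccontr)
    assume improving: "\<not> red B W c j \<le> 0"
    define z where "z = basic W \<beta> B"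
    have z: "feasible \<beta> z"
      unfolding z_def using feasible_basic[OF B] pos by (simp add: less_imp_le)
    have "\<exists>v\<in>B. - tab W v j < 0"
    proof (rule ccontr)
      assume "\<not> (\<exists>v\<in>B. - tab W v j < 0)"
      then have "feasible (\<lambda>_. 0) (edge B W j)"
        using solves_edge[OF B j] by (auto simp: feasible_def edge_def)
      from no_ray[OF this] show False
        using j by (auto simp: edge_def)
    qed
    then obtain u where u: "u \<in> B" "tab W u j > 0"
      and step: "\<forall>v\<in>B. 0 \<le> sol W \<beta> v + (sol W \<beta> u / tab W u j) * - tab W v j"
      using ratio_test[of B "sol W \<beta>" "\<lambda>v. - tab W v j"] pos basis_finite[OF B]
      by (metis minus_minus neg_less_0_iff_less less_imp_le)
    define \<theta> where "\<theta> = sol W \<beta> u / tab W u j"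
    have \<theta>: "\<theta> > 0"
      using u pos by (simp add: \<theta>_def)
    define z' where "z' v = z v + \<theta> * edge B W j v" for v
    have z': "solves \<beta> z'"
      unfolding z'_def using solves_add_edge[OF B j] z by (simp add: feasible_def)
    obtain W' where W': "basis (insert j (B - {u})) W'"
      using pivot[OF B u(1) j] u(2) by auto
    define B' where "B' = insert j (B - {u})"
    have B': "basis B' (wit B')"
      unfolding B'_def by (rule wit[OF W'])
    have "z' u = 0"
      using u j by (auto simp: z'_def z_def edge_def basic_def \<theta>_def)
    then have off: "z' v = 0" if "v \<in> V - B'" for v
      using that by (auto simp: z'_def z_def edge_def basic_def B'_def)
    have on: "sol (wit B') \<beta> v = z' v" if "v \<in> B'" for v
      using basic_solution_unique[OF B' z' that off] by simp
    have "0 \<le> z' v" if "v \<in> B'" for v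
      using that step \<theta> j by (auto simp: z'_def z_def edge_def basic_def B'_def \<theta>_def)
    then have "B' \<in> F"
      using B' on by (simp add: F_def)
    have "obj B' = (\<Sum>v\<in>V. c v * z' v)"
      unfolding obj_def using on off by (intro sum.cong) (auto simp: basic_def)
    also have "\<dots> = (\<Sum>v\<in>V. c v * z v) + \<theta> * (\<Sum>v\<in>V. c v * edge B W j v)"
      by (simp add: z'_def distrib_left sum.distrib sum_distrib_left mult.left_commute)
    also have "\<dots> = (\<Sum>v\<in>V. c v * z v) + \<theta> * red B W c j"
      by (simp add: sum_edge[OF B j] red_def)
    also have "(\<Sum>v\<in>V. c v * z v) = obj B"
      by (simp add: obj_def z_def W_def)
    finally have "obj B < obj B'"
      using \<theta> improving by simp
    with max[OF \<open>B' \<in> F\<close>] show False by simp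
  qed
  then show ?thesis
    using B pos less_imp_le by blast
qed

text \<open>
  Degeneracy is removed by adding \<open>M e\<close> to the right-hand side, where \<open>e\<close> consists of distinct
  positive powers of a small \<open>s > 0\<close>; feasibility is preserved by adding \<open>e\<close> to a feasible point. Each
  coordinate of a basic solution becomes a nonzero polynomial in \<open>s\<close>. For small \<open>s\<close> none of them
  vanishes and those that were negative stay negative, so a basis that is feasible after the
  perturbation was feasible before. Reduced costs do not involve the right-hand side at all.
\<close>

theorem optimal_basis_exists:
  assumes ex: "basis B0 W0" "feasible \<beta> z0"
    and no_ray: "\<And>d. feasible (\<lambda>_. 0) d \<Longrightarrow> \<forall>v\<in>V. d v = 0"
  shows "\<exists>B W. basis B W \<and> (\<forall>v\<in>B. 0 \<le> sol W \<beta> v) \<and> (\<forall>j\<in>V - B. red B W c j \<le> 0)"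
proof -
  obtain e :: "'v \<Rightarrow> nat" where e: "inj_on e V"
    using finite_V finite_imp_inj_to_nat_seg by blast
  define \<beta>' where "\<beta>' s r = \<beta> r + (\<Sum>v\<in>V. M r v * s ^ Suc (e v))" for s :: real and r
  define pp where "pp W v = [:sol W \<beta> v:] + (\<Sum>u\<in>V. monom (tab W v u) (Suc (e u)))" for W v
  have poly_pp: "poly (pp W v) s = sol W (\<beta>' s) v" for W v s
  proof -
    have "sol W (\<beta>' s) v = sol W \<beta> v + (\<Sum>u\<in>V. tab W v u * s ^ Suc (e u))"
      by (rule sol_of_columns) (simp add: \<beta>'_def)
    then show ?thesis
      by (simp add: pp_def poly_sum poly_monom)
  qed
  \<comment> \<open>The tableau column of a basic variable is a unit vector, so the monomial belonging to \<open>v\<close> survives.\<close>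
  have pp_nz: "pp W v \<noteq> 0" if "basis B W" "v \<in> B" for B W v
  proof -
    have v: "v \<in> V" using that basis_subset by blast
    have "coeff (pp W v) (Suc (e v)) = (\<Sum>u\<in>V. if u = v then tab W v u else 0)"
      using e v by (auto simp: pp_def coeff_sum inj_on_eq_iff intro!: sum.cong)
    then have "coeff (pp W v) (Suc (e v)) = 1"
      using v finite_V tab_basic[OF that that(2)] by simp
    then show ?thesis by auto
  qed
  define wit where "wit B = (SOME W. basis B W)" for B
  have wit: "basis B (wit B)" if "basis B W" for B W
    unfolding wit_def using that by (rule someI[where P = "basis B"])
  have wit_eq: "sol W \<gamma> v = sol (wit B) \<gamma> v" if "basis B W" "v \<in> B" for B W v \<gamma>
    using sol_unique[OF that(1) wit[OF that(1)] that(2)] .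
  \<comment> \<open>At such \<open>s\<close> the perturbed coordinate is nonzero, and negative if it was negative before.\<close>
  define stable where "stable B v s \<longleftrightarrow>
      sol (wit B) (\<beta>' s) v \<noteq> 0 \<and> (sol (wit B) \<beta> v < 0 \<longrightarrow> sol (wit B) (\<beta>' s) v < 0)" for B v s
  have ev: "eventually (\<lambda>s. stable B v s) (at_right 0)" if "basis B W" "v \<in> B" for B W v
  proof -
    have "((\<lambda>s. poly (pp (wit B) v) s) \<longlongrightarrow> poly (pp (wit B) v) 0) (at_right 0)"
      by (intro tendsto_intros)
    moreover have "poly (pp (wit B) v) 0 = sol (wit B) \<beta> v"
      unfolding poly_pp \<beta>'_def by simp
    ultimately have lim: "((\<lambda>s. sol (wit B) (\<beta>' s) v) \<longlongrightarrow> sol (wit B) \<beta> v) (at_right 0)"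
      by (simp add: poly_pp)
    have "eventually (\<lambda>s. sol (wit B) \<beta> v < 0 \<longrightarrow> sol (wit B) (\<beta>' s) v < 0) (at_right 0)"
    proof (cases "sol (wit B) \<beta> v < 0")
      case True
      from order_tendstoD(2)[OF lim this] show ?thesis by (rule eventually_mono) simp
    qed simp
    moreover have "eventually (\<lambda>s. sol (wit B) (\<beta>' s) v \<noteq> 0) (at_right 0)"
      using eventually_poly_nonzero_at_right[OF pp_nz[OF wit[OF that(1)] that(2)], of 0]
      by (simp add: poly_pp)
    ultimately show ?thesis
      unfolding stable_def by eventually_elim simp
  qed
  have "eventually (\<lambda>s. \<forall>B\<in>{B \<in> Pow V. \<exists>W. basis B W}. \<forall>v\<in>B. stable B v s) (at_right 0)"
    using finite_V ev by (intro eventually_ball_finite ballI) (auto intro: finite_subset)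
  moreover have "eventually (\<lambda>s::real. s > 0) (at_right 0)"
    by (rule eventually_at_right_less)
  ultimately have "eventually (\<lambda>s. s > 0 \<and> (\<forall>B W. basis B W \<longrightarrow> (\<forall>v\<in>B. stable B v s))) (at_right 0)"
    by eventually_elim (use basis_subset in blast)
  then obtain s where s: "s > 0" and stable: "\<And>B W v. basis B W \<Longrightarrow> v \<in> B \<Longrightarrow> stable B v s"
    using eventually_happens'[OF trivial_limit_at_right_real] by blast
  have "feasible (\<beta>' s) (\<lambda>v. z0 v + s ^ Suc (e v))"
    using ex(2) s by (auto simp: feasible_def solves_def \<beta>'_def distrib_left sum.distrib)
  from optimal_basis_nondegenerate[OF ex(1) this _ no_ray, of c]
  obtain B W where B: "basis B W" and feas: "\<And>v. v \<in> B \<Longrightarrow> 0 \<le> sol W (\<beta>' s) v"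
    and opt: "\<forall>j\<in>V - B. red B W c j \<le> 0"
    using stable unfolding stable_def by (metis wit_eq)
  have "0 \<le> sol W \<beta> v" if "v \<in> B" for v
    using stable[OF B that] feas[OF that] wit_eq[OF B that] unfolding stable_def by force
  then show ?thesis using B opt by blast
qed

end

text \<open>
  The inverse of the block triangular matrix with rows \<open>(N, 0)\<close> and \<open>(g, \<sigma>)\<close> has rows
  \<open>(W, 0)\<close> and \<open>(- g W / \<sigma>, 1 / \<sigma>)\<close>, if \<open>W\<close> inverts \<open>N\<close>. Adding a constraint with its own
  slack variable to a node borders the slack basis in this way.
\<close>

lemma bordered_basis:
  assumes R: "linear_system R V" "r0 \<notin> R" "v0 \<notin> V"
    and B: "linear_system.basis R V M B W"
    and zero: "\<And>r. r \<in> R \<Longrightarrow> M r v0 = 0" and corner: "M r0 v0 \<noteq> 0"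
  shows "\<exists>W'. linear_system.basis (insert r0 R) (insert v0 V) M (insert v0 B) W'"
proof -
  interpret linear_system R V M by (rule R)
  interpret new: linear_system "insert r0 R" "insert v0 V" M
    using finite_R finite_V by unfold_locales auto
  define \<sigma> where "\<sigma> = M r0 v0"
  have \<sigma>: "\<sigma> \<noteq> 0" using corner by (simp add: \<sigma>_def)
  define W' where "W' v r = (if v = v0 then (if r = r0 then 1 else - (\<Sum>u\<in>B. M r0 u * W u r)) / \<sigma>
     else if r = r0 then 0 else W v r)" for v r
  have fin: "finite B" "v0 \<notin> B"
    using basis_subset[OF B] basis_finite[OF B] R by auto
  have W'_B: "(\<Sum>v\<in>B. g v * W' v i) = (if i = r0 then 0 else \<Sum>v\<in>B. g v * W v i)" for g i
    using fin by (auto simp: W'_def intro!: sum.cong sum.neutral)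
  have W'_R: "(\<Sum>i\<in>R. W' v i * g i) = (\<Sum>i\<in>R. W v i * g i)" if "v \<in> B" for v g
    using fin that R by (auto simp: W'_def intro!: sum.cong)
  have W'_R0: "(\<Sum>i\<in>R. W' v0 i * g i) = - (\<Sum>u\<in>B. M r0 u * (\<Sum>i\<in>R. W u i * g i)) / \<sigma>" for g
  proof -
    have "(\<Sum>i\<in>R. W' v0 i * g i) = (\<Sum>i\<in>R. - (\<Sum>u\<in>B. M r0 u * (W u i * g i)) / \<sigma>)"
      using R by (auto simp: W'_def sum_distrib_right mult.assoc intro!: sum.cong)
    also have "\<dots> = - (\<Sum>i\<in>R. \<Sum>u\<in>B. M r0 u * (W u i * g i)) / \<sigma>"
      by (simp add: sum_negf sum_divide_distrib)
    also have "(\<Sum>i\<in>R. \<Sum>u\<in>B. M r0 u * (W u i * g i)) = (\<Sum>u\<in>B. M r0 u * (\<Sum>i\<in>R. W u i * g i))"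
      by (subst sum.swap) (simp add: sum_distrib_left)
    finally show ?thesis .
  qed
  have right: "(\<Sum>j\<in>insert v0 B. M i j * W' j i') = (if i = i' then 1 else 0)"
    if "i \<in> insert r0 R" "i' \<in> insert r0 R" for i i'
  proof -
    have "(\<Sum>j\<in>insert v0 B. M i j * W' j i')
        = M i v0 * W' v0 i' + (if i' = r0 then 0 else \<Sum>j\<in>B. M i j * W j i')"
      using fin by (simp add: W'_B)
    moreover have "W' v0 i' = (if i' = r0 then 1 else - (\<Sum>u\<in>B. M r0 u * W u i')) / \<sigma>"
      by (simp add: W'_def)
    ultimately show ?thesis
      using that B R(2) \<sigma> by (auto simp: zero basis_def \<sigma>_def[symmetric])
  qed
  have left: "(\<Sum>i\<in>insert r0 R. W' j i * M i j') = (if j = j' then 1 else 0)"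
    if "j \<in> insert v0 B" "j' \<in> insert v0 B" for j j'
  proof -
    have split: "(\<Sum>i\<in>insert r0 R. W' j i * M i j') = W' j r0 * M r0 j' + (\<Sum>i\<in>R. W' j i * M i j')"
      using R finite_R by simp
    have old: "(\<Sum>i\<in>R. W u i * M i j') = (if u = j' then 1 else 0)" if "u \<in> B" for u
      using that \<open>j' \<in> insert v0 B\<close> B fin by (auto simp: basis_def zero)
    show ?thesis
    proof (cases "j = v0")
      case True
      have "(\<Sum>u\<in>B. M r0 u * (\<Sum>i\<in>R. W u i * M i j')) = (\<Sum>u\<in>B. if u = j' then M r0 u else 0)"
        using old by (intro sum.cong) auto
      also have "\<dots> = (if j' = v0 then 0 else M r0 j')"
        using fin that by auto
      finally show ?thesis
        unfolding split unfolding True W'_R0 using \<sigma> by (auto simp: W'_def \<sigma>_def)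
    next
      case False
      then show ?thesis
        using that old unfolding split by (simp add: W'_R) (simp add: W'_def)
    qed
  qed
  have "new.basis (insert v0 B) W'"
    unfolding new.basis_def using right left basis_subset[OF B] by blast
  then show ?thesis by blast
qed

section \<open>Nodes as linear systems\<close>

abbreviation node_basis ::
  "real ^ 'n ^ 'm::finite \<Rightarrow> ('n::finite, 'm) node \<Rightarrow> ('n, 'm) var set
     \<Rightarrow> (('n, 'm) var \<Rightarrow> 'm row \<Rightarrow> real) \<Rightarrow> bool" where
  "node_basis A cs \<equiv> linear_system.basis (rows cs) (vars cs) (std_mat A cs)"

abbreviation node_solves ::
  "real ^ 'n ^ 'm::finite \<Rightarrow> ('n::finite, 'm) node \<Rightarrow> ('m row \<Rightarrow> real)
     \<Rightarrow> (('n, 'm) var \<Rightarrow> real) \<Rightarrow> bool" where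
  "node_solves A cs \<equiv> linear_system.solves (rows cs) (vars cs) (std_mat A cs)"

abbreviation node_red ::
  "real ^ 'n ^ 'm::finite \<Rightarrow> ('n::finite, 'm) node \<Rightarrow> ('n, 'm) var set
     \<Rightarrow> (('n, 'm) var \<Rightarrow> 'm row \<Rightarrow> real) \<Rightarrow> (('n, 'm) var \<Rightarrow> real) \<Rightarrow> ('n, 'm) var \<Rightarrow> real" where
  "node_red A cs \<equiv> linear_system.red (rows cs) (std_mat A cs)"

lemma finite_rows [simp]: "finite (rows (cs :: ('n, 'm::finite) node))"
  by (simp add: rows_def)

lemma finite_vars [simp]: "finite (vars (cs :: ('n::finite, 'm::finite) node))"
  by (simp add: vars_def)

interpretation node: linear_system "rows cs" "vars cs" "std_mat A cs"
  for A :: "real ^ 'n::finite ^ 'm::finite" and cs :: "('n, 'm) node"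
  by unfold_locales simp_all

lemma std_feasible_iff:
  "std_feasible A b cs z \<longleftrightarrow> (\<forall>v\<in>vars cs. 0 \<le> z v) \<and> node_solves A cs (std_rhs b cs) z"
  by (simp add: std_feasible_def node.solves_def)

lemma is_basis_iff: "is_basis A cs B \<longleftrightarrow> (\<exists>W. node_basis A cs B W)"
  by (auto simp: is_basis_def inverse_on_def node.basis_def)

lemma basis_inv_basis:
  assumes "is_basis A cs B"
  shows "node_basis A cs B (basis_inv A cs B)"
proof -
  have "inverse_on A cs B (basis_inv A cs B)"
    unfolding basis_inv_def using assms
    by (auto simp: is_basis_def intro: someI[where P = "inverse_on A cs B"])
  then show ?thesis
    using assms by (simp add: is_basis_def inverse_on_def node.basis_def)
qed

lemma basic_sol_eq:
  "basic_sol A b cs B = linear_system.basic (rows cs) (basis_inv A cs B) (std_rhs b cs) B"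
  by (simp add: fun_eq_iff basic_sol_def node.basic_def node.sol_def)

lemma reduced_eq: "reduced A cs B p = node_red A cs B (basis_inv A cs B) (extend0 p)"
  by (simp add: fun_eq_iff reduced_def tableau_def node.red_def node.sol_def)

lemma std_feasible_basic_sol:
  assumes "is_basis A cs B" "\<forall>v\<in>B. 0 \<le> basic_sol A b cs B v"
  shows "std_feasible A b cs (basic_sol A b cs B)"
proof -
  have "linear_system.feasible (rows cs) (vars cs) (std_mat A cs) (std_rhs b cs) (basic_sol A b cs B)"
    unfolding basic_sol_eq using assms(2)
    by (intro node.feasible_basic[OF basis_inv_basis[OF assms(1)]]) (simp add: basic_sol_eq node.basic_def)
  then show ?thesis
    by (simp add: node.feasible_def std_feasible_iff)
qed

lemma basic_point_in_node_dom:
  "is_basis A cs B \<Longrightarrow> \<forall>v\<in>B. 0 \<le> basic_sol A b cs B v \<Longrightarrow> basic_point A b cs B \<in> node_dom A b cs"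
  unfolding node_dom_def basic_point_def using std_feasible_basic_sol by blast

lemma sum_vars:
  fixes cs :: "('n::finite, 'm::finite) node"
  shows "(\<Sum>v\<in>vars cs. g v) = (\<Sum>j\<in>UNIV. g (Orig j)) + (\<Sum>r\<in>rows cs. g (Slack r))"
proof -
  have "(\<Sum>v\<in>vars cs. g v) = (\<Sum>v\<in>range Orig. g v) + (\<Sum>v\<in>Slack ` rows cs. g v)"
    unfolding vars_def by (intro sum.union_disjoint) auto
  then show ?thesis
    by (simp add: sum.reindex inj_on_def)
qed

lemma sum_extend0:
  fixes cs :: "('n::finite, 'm::finite) node"
  shows "(\<Sum>v\<in>vars cs. extend0 p v * z v) = p \<bullet> orig_part z"
  by (simp add: sum_vars inner_vec_def orig_part_def)

text \<open>
  Over the feasible points of a node a linear function of the original variables is affine in the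
  non-basic variables, with the reduced vector as coefficients.
\<close>

lemma linear_in_nonbasic:
  assumes "is_basis A cs B" "std_feasible A b cs z"
  shows "p \<bullet> orig_part z
    = p \<bullet> basic_point A b cs B + (\<Sum>j\<in>vars cs - B. reduced A cs B p j * z j)"
  using node.objective_in_nonbasic[OF basis_inv_basis[OF assms(1)], of "std_rhs b cs" z "extend0 p"] assms(2)
  by (simp add: sum_extend0 std_feasible_iff reduced_eq basic_point_def flip: basic_sol_eq)

text \<open>
  For positive denominators the left-hand side has the sign of \<open>val F x - val F x'\<close>, so reduced
  gradients decide how a linear fractional function compares with its value at the basic point.
\<close>

lemma cross_difference:
  assumes "is_basis A cs B" "std_feasible A b cs z"
  defines "x \<equiv> orig_part z" and "x' \<equiv> basic_point A b cs B"
  shows "numer F x * denom F x' - numer F x' * denom F x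
    = (\<Sum>j\<in>vars cs - B. reduced_gradient A b cs B F j * z j)"
proof -
  define n where "n = (\<Sum>j\<in>vars cs - B. reduced A cs B (num F) j * z j)"
  define d where "d = (\<Sum>j\<in>vars cs - B. reduced A cs B (den F) j * z j)"
  have "numer F x = numer F x' + n" "denom F x = denom F x' + d"
    using linear_in_nonbasic[OF assms(1,2)]
    by (simp_all add: numer_def denom_def x_def x'_def n_def d_def)
  then have "numer F x * denom F x' - numer F x' * denom F x = denom F x' * n - numer F x' * d"
    by (simp add: algebra_simps)
  also have "\<dots> = (\<Sum>j\<in>vars cs - B. reduced_gradient A b cs B F j * z j)"
    unfolding reduced_gradient_def n_def d_def x'_def[symmetric] sum_distrib_left
    by (simp add: sum_subtractf left_diff_distrib mult.assoc)
  finally show ?thesis .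
qed

section \<open>Constraints that refer to earlier rows\<close>

text \<open>
  The invariant of the nodes that the algorithm creates. A constraint only involves variables
  that exist when it is added, which makes the slack part of the equality form triangular, and it has
  integer coefficients, which passes integrality on to the new slack variable.
\<close>

inductive admissible :: "('n, 'm) node \<Rightarrow> bool" where
  Nil: "admissible []"
| snoc: "\<lbrakk>admissible cs; \<And>v. lhs c v \<noteq> 0 \<Longrightarrow> v \<in> vars cs; \<And>v. lhs c v \<in> \<int>; rhs c \<in> \<int>\<rbrakk>
    \<Longrightarrow> admissible (cs @ [c])"

lemma rows_snoc: "rows (cs @ [c]) = insert (Added (length cs)) (rows cs)"
  by (auto simp: rows_def lessThan_Suc)

lemma vars_snoc: "vars (cs @ [c]) = insert (Slack (Added (length cs))) (vars cs)"
  by (simp add: vars_def rows_snoc)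

lemma new_row: "Added (length cs) \<notin> rows cs"
  by (auto simp: rows_def)

lemma new_var: "Slack (Added (length cs)) \<notin> vars cs"
  using new_row by (auto simp: vars_def)

lemma Orig_in_vars: "Orig j \<in> vars cs"
  by (simp add: vars_def)

lemma Slack_Given_in_vars: "Slack (Given i) \<in> vars cs"
  by (simp add: vars_def rows_def)

lemma admissible_lhs:
  "admissible cs \<Longrightarrow> t < length cs \<Longrightarrow> lhs (cs ! t) v \<noteq> 0 \<Longrightarrow> v \<in> vars cs"
  by (induction rule: admissible.induct) (auto simp: nth_append vars_snoc split: if_splits)

lemma std_mat_outside:
  assumes "admissible cs" "r \<in> rows cs" "v \<notin> vars cs"
  shows "std_mat A cs r v = 0"
proof (cases r)
  case (Given i)
  with assms(3) show ?thesis
    by (cases v) (auto simp: Orig_in_vars Slack_Given_in_vars)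
next
  case (Added t)
  then have "t < length cs" "v \<noteq> Slack (Added t)"
    using assms by (auto simp: rows_def vars_def)
  with Added show ?thesis
    using admissible_lhs[OF assms(1)] assms(3) by auto
qed

lemma std_mat_snoc: "r \<in> rows cs \<Longrightarrow> std_mat A (cs @ [c]) r v = std_mat A cs r v"
  by (cases r; cases v) (auto simp: rows_def nth_append)

lemma std_rhs_snoc: "r \<in> rows cs \<Longrightarrow> std_rhs b (cs @ [c]) r = std_rhs b cs r"
  by (cases r) (auto simp: rows_def nth_append)

text \<open>
  A new constraint leaves the old equations unchanged, as these do not involve the new slack variable.
\<close>

lemma node_solves_snoc:
  fixes cs :: "('n::finite, 'm::finite) node"
  assumes "admissible cs"
  shows "node_solves A (cs @ [c]) \<beta> z \<longleftrightarrow> node_solves A cs \<beta> z \<and>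
    (\<Sum>v\<in>vars cs. lhs c v * z v) + slack_sign c * z (Slack (Added (length cs))) = \<beta> (Added (length cs))"
proof -
  have old: "(\<Sum>v\<in>vars (cs @ [c]). std_mat A (cs @ [c]) r v * z v) = (\<Sum>v\<in>vars cs. std_mat A cs r v * z v)"
    if "r \<in> rows cs" for r
    using that std_mat_outside[OF assms that new_var] new_var[of cs] by (simp add: vars_snoc std_mat_snoc)
  have "(\<Sum>v\<in>vars cs. std_mat A (cs @ [c]) (Added (length cs)) v * z v) = (\<Sum>v\<in>vars cs. lhs c v * z v)"
    using new_var[of cs] by (intro sum.cong) auto
  then have new: "(\<Sum>v\<in>vars (cs @ [c]). std_mat A (cs @ [c]) (Added (length cs)) v * z v)
    = (\<Sum>v\<in>vars cs. lhs c v * z v) + slack_sign c * z (Slack (Added (length cs)))"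
    using new_var[of cs] by (simp add: vars_snoc)
  show ?thesis
    unfolding node.solves_def using old new by (simp add: rows_snoc) blast
qed

lemma std_feasible_snoc:
  fixes cs :: "('n::finite, 'm::finite) node"
  assumes "admissible cs"
  shows "std_feasible A b (cs @ [c]) z \<longleftrightarrow> std_feasible A b cs z \<and> 0 \<le> z (Slack (Added (length cs))) \<and>
    (\<Sum>v\<in>vars cs. lhs c v * z v) + slack_sign c * z (Slack (Added (length cs))) = rhs c"
proof -
  have "node_solves A cs (std_rhs b (cs @ [c])) z = node_solves A cs (std_rhs b cs) z"
    by (simp add: node.solves_def std_rhs_snoc)
  then show ?thesis
    unfolding std_feasible_iff node_solves_snoc[OF assms] by (auto simp: vars_snoc)
qed

lemma std_feasible_cong:
  assumes "\<And>v. v \<in> vars cs \<Longrightarrow> z v = z' v"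
  shows "std_feasible A b cs z = std_feasible A b cs z'"
  using assms by (simp add: std_feasible_def cong: sum.cong)

lemma orig_part_cong: "(\<And>v. v \<in> vars cs \<Longrightarrow> z v = z' v) \<Longrightarrow> orig_part z = orig_part z'"
  by (simp add: orig_part_def Orig_in_vars)

lemma slack_sign_cases: "slack_sign c = 1 \<or> slack_sign c = - 1"
  by (cases c) auto

text \<open>
  The value of the new slack variable is forced by its row, and it is nonnegative exactly when the
  constraint holds; the sign of the slack variable is its own inverse.
\<close>

lemma std_feasible_extend:
  fixes cs :: "('n::finite, 'm::finite) node"
  assumes "admissible cs" "std_feasible A b cs z"
    and sat: "0 \<le> slack_sign c * (rhs c - (\<Sum>v\<in>vars cs. lhs c v * z v))"
  obtains z' where "std_feasible A b (cs @ [c]) z'" "\<And>v. v \<in> vars cs \<Longrightarrow> z' v = z v"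
proof -
  define s where "s = slack_sign c * (rhs c - (\<Sum>v\<in>vars cs. lhs c v * z v))"
  define z' where "z' = z(Slack (Added (length cs)) := s)"
  have eq: "z' v = z v" if "v \<in> vars cs" for v
    using that new_var[of cs] by (auto simp: z'_def)
  have "(\<Sum>v\<in>vars cs. lhs c v * z' v) + slack_sign c * s = rhs c"
    using slack_sign_cases[of c] eq by (auto simp: s_def cong: sum.cong)
  then have "std_feasible A b (cs @ [c]) z'"
    using assms std_feasible_cong[of cs z' z] eq
    by (simp add: std_feasible_snoc s_def[symmetric]) (simp add: z'_def)
  then show thesis using that eq by blast
qed

lemma given_row:
  "(\<Sum>v\<in>vars cs. std_mat A cs (Given i) v * z v) = (A *v orig_part z) $ i + z (Slack (Given i))"
proof -
  have "(\<Sum>r\<in>rows cs. std_mat A cs (Given i) (Slack r) * z (Slack r))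
      = (\<Sum>r\<in>rows cs. if r = Given i then z (Slack r) else 0)"
    by (intro sum.cong) auto
  also have "\<dots> = z (Slack (Given i))"
    by (simp add: rows_def)
  finally show ?thesis
    by (simp add: sum_vars matrix_vector_mult_def orig_part_def)
qed

lemma std_feasible_given_slack:
  assumes "std_feasible A b cs z"
  shows "z (Slack (Given i)) = (b - A *v orig_part z) $ i"
proof -
  have "Given i \<in> rows cs"
    by (simp add: rows_def)
  then have "(\<Sum>v\<in>vars cs. std_mat A cs (Given i) v * z v) = b $ i"
    using assms unfolding std_feasible_def by fastforce
  then show ?thesis
    by (simp add: given_row)
qed

lemma std_feasible_polyh:
  assumes "std_feasible A b cs z"
  shows "orig_part z \<in> polyh A b"
proof -
  have nonneg: "0 \<le> z v" if "v \<in> vars cs" for v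
    using assms that by (simp add: std_feasible_def)
  have "(A *v orig_part z) $ i \<le> b $ i" for i
    using nonneg[OF Slack_Given_in_vars, of i] std_feasible_given_slack[OF assms, of i] by simp
  then show ?thesis
    using nonneg[OF Orig_in_vars] by (simp add: polyh_def orig_part_def)
qed

lemma node_dom_subset_polyh: "node_dom A b cs \<subseteq> polyh A b"
  using std_feasible_polyh by (auto simp: node_dom_def)

text \<open>
  By triangularity the original variables determine the slack variables one after the other. The
  right-hand side is arbitrary so that rays, which solve the homogeneous system, are covered too.
\<close>

lemma slacks_unique:
  fixes cs :: "('n::finite, 'm::finite) node"
  assumes "admissible cs" "node_solves A cs \<beta> z" "node_solves A cs \<beta> z'" "orig_part z = orig_part z'"
  shows "\<forall>v\<in>vars cs. z v = z' v"
  using assms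
proof (induction rule: admissible.induct)
  case Nil
  have "z (Slack (Given i)) = z' (Slack (Given i))" for i
  proof -
    have "Given i \<in> rows ([] :: ('n, 'm) node)"
      by (simp add: rows_def)
    then have "(\<Sum>v\<in>vars []. std_mat A [] (Given i) v * z v) = (\<Sum>v\<in>vars []. std_mat A [] (Given i) v * z' v)"
      using Nil unfolding node.solves_def by simp
    then show ?thesis
      using Nil by (simp add: given_row)
  qed
  moreover have "z (Orig j) = z' (Orig j)" for j
    using Nil(3) by (simp add: orig_part_def vec_eq_iff)
  ultimately show ?case
    by (auto simp: vars_def rows_def)
next
  case (snoc cs c)
  have eq: "\<forall>v\<in>vars cs. z v = z' v"
    using snoc by (simp add: node_solves_snoc)
  then have "(\<Sum>v\<in>vars cs. lhs c v * z v) = (\<Sum>v\<in>vars cs. lhs c v * z' v)"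
    by simp
  then have "slack_sign c * z (Slack (Added (length cs))) = slack_sign c * z' (Slack (Added (length cs)))"
    using snoc.prems(1,2) unfolding node_solves_snoc[OF snoc.hyps(1)]
    by (metis add_left_cancel)
  then have "z (Slack (Added (length cs))) = z' (Slack (Added (length cs)))"
    using slack_sign_cases[of c] by auto
  with eq show ?case
    by (simp add: vars_snoc)
qed

lemma slacks_integer:
  fixes cs :: "('n::finite, 'm::finite) node"
  assumes "admissible cs" "std_feasible A b cs z" "integer_point (orig_part z)"
    "\<forall>i. (b - A *v orig_part z) $ i \<in> \<int>"
  shows "\<forall>v\<in>vars cs. z v \<in> \<int>"
  using assms
proof (induction rule: admissible.induct)
  case Nil
  have "z (Slack (Given i)) \<in> \<int>" for i
    using Nil std_feasible_given_slack by metis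
  moreover have "z (Orig j) \<in> \<int>" for j
    using Nil by (simp add: integer_point_def orig_part_def)
  ultimately show ?case
    by (auto simp: vars_def rows_def)
next
  case (snoc cs c)
  have int: "\<forall>v\<in>vars cs. z v \<in> \<int>"
    using snoc by (simp add: std_feasible_snoc)
  then have "(\<Sum>v\<in>vars cs. lhs c v * z v) \<in> \<int>"
    using snoc.hyps by (intro Ints_sum Ints_mult) auto
  moreover have "slack_sign c * z (Slack (Added (length cs))) = rhs c - (\<Sum>v\<in>vars cs. lhs c v * z v)"
    using snoc.prems snoc.hyps by (simp add: std_feasible_snoc)
  ultimately have "slack_sign c * z (Slack (Added (length cs))) \<in> \<int>"
    using snoc.hyps by simp
  then have "z (Slack (Added (length cs))) \<in> \<int>"
    using slack_sign_cases[of c] by (auto simp: minus_in_Ints_iff)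
  with int show ?case
    by (simp add: vars_snoc)
qed

text \<open>
  The slack columns form a triangular matrix with diagonal entries \<open>1\<close> and \<open>- 1\<close>. This basis
  need not be feasible; it only provides the starting point for pivoting.
\<close>

lemma slack_basis:
  fixes cs :: "('n::finite, 'm::finite) node"
  assumes "admissible cs"
  shows "\<exists>W. node_basis A cs (Slack ` rows cs) W"
  using assms
proof (induction rule: admissible.induct)
  case Nil
  define W :: "('n, 'm) var \<Rightarrow> 'm row \<Rightarrow> real" where "W v r = (if v = Slack r then 1 else 0)" for v r
  have "(\<Sum>j\<in>Slack ` rows []. std_mat A [] (Given i) j * W j (Given i')) = (if i = i' then 1 else 0)" for i i'
    by (simp add: sum.reindex inj_on_def W_def rows_def mult_delta_left mult_delta_right)
  moreover have "(\<Sum>k\<in>rows []. W (Slack (Given i)) k * std_mat A [] k (Slack (Given i'))) = (if i = i' then 1 else 0)" for i i'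
    by (simp add: sum.reindex inj_on_def W_def rows_def mult_delta_left mult_delta_right)
  ultimately have "node_basis A [] (Slack ` rows []) W"
    unfolding node.basis_def by (auto simp: rows_def vars_def)
  then show ?case by blast
next
  case (snoc cs c)
  then obtain W where "node_basis A cs (Slack ` rows cs) W"
    by blast
  then have "linear_system.basis (rows cs) (vars cs) (std_mat A (cs @ [c])) (Slack ` rows cs) W"
    by (simp add: linear_system.basis_def[OF node.linear_system_axioms] std_mat_snoc)
  then have "\<exists>W'. linear_system.basis (insert (Added (length cs)) (rows cs))
      (insert (Slack (Added (length cs))) (vars cs)) (std_mat A (cs @ [c]))
      (insert (Slack (Added (length cs))) (Slack ` rows cs)) W'"
  proof (rule bordered_basis[OF node.linear_system_axioms new_row new_var])
    show "std_mat A (cs @ [c]) r (Slack (Added (length cs))) = 0" if "r \<in> rows cs" for r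
      using std_mat_outside[OF \<open>admissible cs\<close> that new_var] by (simp add: std_mat_snoc[OF that])
    show "std_mat A (cs @ [c]) (Added (length cs)) (Slack (Added (length cs))) \<noteq> 0"
      using slack_sign_cases[of c] by auto
  qed
  then show ?case
    by (simp add: rows_snoc vars_snoc)
qed

section \<open>Optimal bases for linear fractional objectives\<close>

lemma optimal_basis_basic_point:
  assumes "optimal_basis A b F cs B"
  shows "std_feasible A b cs (basic_sol A b cs B)" "basic_point A b cs B \<in> node_dom A b cs"
    "basic_point A b cs B \<in> polyh A b"
  using assms std_feasible_basic_sol basic_point_in_node_dom node_dom_subset_polyh
  unfolding optimal_basis_def by blast+

text \<open>
  A nonnegative solution of the homogeneous system moves a feasible point within the polytope for
  arbitrarily long times, so its original part vanishes, and with it all of its slack part.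
\<close>

lemma bounded_polyh_no_ray:
  fixes cs :: "('n::finite, 'm::finite) node"
  assumes "admissible cs" "bounded (polyh A b)" "std_feasible A b cs z"
    and d: "\<forall>v\<in>vars cs. 0 \<le> d v" "node_solves A cs (\<lambda>_. 0) d"
  shows "\<forall>v\<in>vars cs. d v = 0"
proof -
  obtain C where C: "\<And>x. x \<in> polyh A b \<Longrightarrow> norm x \<le> C"
    using assms(2) by (auto simp: bounded_iff)
  have "d (Orig j) = 0" for j
  proof (rule ccontr)
    assume "d (Orig j) \<noteq> 0"
    with d have pos: "d (Orig j) > 0"
      using Orig_in_vars[of j cs] by force
    have z: "\<forall>v\<in>vars cs. 0 \<le> z v" "node_solves A cs (std_rhs b cs) z"
      using assms(3) by (auto simp: std_feasible_iff)
    have C0: "0 \<le> C"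
      using C[OF std_feasible_polyh[OF assms(3)]] norm_ge_zero order_trans by blast
    \<comment> \<open>At time \<open>\<theta>\<close> coordinate \<open>j\<close> has exceeded the bound \<open>C\<close>.\<close>
    define \<theta> where "\<theta> = (C + 1) / d (Orig j)"
    have \<theta>: "\<theta> \<ge> 0" "\<theta> * d (Orig j) = C + 1"
      using pos C0 by (simp_all add: \<theta>_def)
    have "node_solves A cs (std_rhs b cs) (\<lambda>v. z v + \<theta> * d v)"
      using node.solves_add[OF z(2) d(2), of \<theta>] by simp
    then have "std_feasible A b cs (\<lambda>v. z v + \<theta> * d v)"
      using z d \<theta> by (simp add: std_feasible_iff)
    then have "norm (orig_part (\<lambda>v. z v + \<theta> * d v)) \<le> C"
      by (intro C std_feasible_polyh)
    then have "\<bar>z (Orig j) + \<theta> * d (Orig j)\<bar> \<le> C"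
      using component_le_norm_cart[of "orig_part (\<lambda>v. z v + \<theta> * d v)" j] by (simp add: orig_part_def)
    moreover have "0 \<le> z (Orig j)"
      using z(1) Orig_in_vars[of j cs] by simp
    ultimately show False
      using \<theta> by simp
  qed
  then have "orig_part d = orig_part (\<lambda>_. 0)"
    by (simp add: orig_part_def)
  moreover have "node_solves A cs (\<lambda>_. 0) (\<lambda>_. 0)"
    by (simp add: node.solves_def)
  ultimately show ?thesis
    using slacks_unique[OF assms(1) d(2), of "\<lambda>_. 0"] by blast
qed

text \<open>
  Let \<open>t\<close> be the largest value of \<open>F\<close> at a feasible basic point, and let \<open>B\<close> be an optimal basis for
  the linear objective \<open>numerator - t * denominator\<close>. The maximum of that objective is \<open>0\<close>: it is at
  least \<open>0\<close> because the basis attaining \<open>t\<close> yields \<open>0\<close>, and at most \<open>0\<close> by maximality of \<open>t\<close>. Hence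
  \<open>F\<close> has value \<open>t\<close> at the basic point of \<open>B\<close>, and there the reduced gradient of \<open>F\<close> is a positive
  multiple of the reduced costs of the linear objective.
\<close>

theorem linfrac_optimal_basis_exists:
  fixes cs :: "('n::finite, 'm::finite) node"
  assumes adm: "admissible cs" and bdd: "bounded (polyh A b)" and ne: "node_dom A b cs \<noteq> {}"
    and pos: "\<And>x. x \<in> polyh A b \<Longrightarrow> denom F x > 0"
  shows "\<exists>B. optimal_basis A b F cs B"
proof -
  obtain z0 where z0: "std_feasible A b cs z0"
    using ne by (auto simp: node_dom_def)
  then have z0': "linear_system.feasible (rows cs) (vars cs) (std_mat A cs) (std_rhs b cs) z0"
    by (simp add: node.feasible_def std_feasible_iff)
  obtain W0 where W0: "node_basis A cs (Slack ` rows cs) W0"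
    using slack_basis[OF adm] by blast
  have no_ray: "\<forall>v\<in>vars cs. d v = 0"
    if "linear_system.feasible (rows cs) (vars cs) (std_mat A cs) (\<lambda>_. 0) d" for d
    using bounded_polyh_no_ray[OF adm bdd z0] that unfolding node.feasible_def by blast
  define FB where "FB = {B. is_basis A cs B \<and> (\<forall>v\<in>B. 0 \<le> basic_sol A b cs B v)}"
  define opt where "opt c B \<longleftrightarrow> (\<forall>j\<in>vars cs - B. node_red A cs B (basis_inv A cs B) c j \<le> 0)" for c B
  have opt_ex: "\<exists>B\<in>FB. opt c B" for c
  proof -
    from node.optimal_basis_exists[OF W0 z0' no_ray, of c]
    obtain B W where W: "node_basis A cs B W"
      and BW: "\<forall>v\<in>B. 0 \<le> linear_system.sol (rows cs) W (std_rhs b cs) v"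
        "\<forall>j\<in>vars cs - B. node_red A cs B W c j \<le> 0"
      by blast
    then have B: "is_basis A cs B"
      by (auto simp: is_basis_iff)
    note W' = basis_inv_basis[OF B]
    have "0 \<le> basic_sol A b cs B v" if "v \<in> B" for v
      using BW(1) that node.sol_unique[OF W W' that, symmetric]
      by (simp add: basic_sol_eq node.basic_def)
    moreover have "opt c B"
      using BW(2) node.red_unique[OF W W'] by (simp add: opt_def)
    ultimately show ?thesis
      using B by (auto simp: FB_def)
  qed
  have "FB \<subseteq> Pow (vars cs)"
    by (auto simp: FB_def is_basis_def)
  then have fin: "finite FB"
    by (rule finite_subset) simp
  have denom_pos: "denom F (basic_point A b cs B) > 0" if "B \<in> FB" for B
    using that basic_point_in_node_dom[of A cs B b] node_dom_subset_polyh[of A b cs]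
    by (auto simp: FB_def intro: pos)
  define vals where "vals = (\<lambda>B. val F (basic_point A b cs B)) ` FB"
  define t where "t = Max vals"
  have "finite vals" "vals \<noteq> {}"
    using fin opt_ex by (auto simp: vals_def)
  then have "t \<in> vals" and t_max: "\<And>s. s \<in> vals \<Longrightarrow> s \<le> t"
    unfolding t_def by simp_all
  then obtain B0 where B0: "B0 \<in> FB" "val F (basic_point A b cs B0) = t"
    unfolding vals_def by blast
  define p where "p = num F - t *\<^sub>R den F"
  obtain B where B: "B \<in> FB" "opt (extend0 p) B"
    using opt_ex by blast
  then have basis: "is_basis A cs B"
    by (simp add: FB_def)
  define x where "x = basic_point A b cs B"
  have gap: "numer F y - t * denom F y = p \<bullet> y + num0 F - t * den0 F" for y
    by (simp add: p_def numer_def denom_def inner_diff_left algebra_simps)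
  have z1: "std_feasible A b cs (basic_sol A b cs B0)"
    using B0 by (auto simp: FB_def intro: std_feasible_basic_sol)
  have "(\<Sum>j\<in>vars cs - B. reduced A cs B p j * basic_sol A b cs B0 j) \<le> 0"
  proof (rule sum_nonpos)
    fix j assume j: "j \<in> vars cs - B"
    then have "0 \<le> basic_sol A b cs B0 j"
      using z1 by (simp add: std_feasible_def)
    moreover have "reduced A cs B p j \<le> 0"
      using B(2) j by (simp add: opt_def reduced_eq)
    ultimately show "reduced A cs B p j * basic_sol A b cs B0 j \<le> 0"
      by (rule mult_nonpos_nonneg[rotated])
  qed
  then have "p \<bullet> basic_point A b cs B0 \<le> p \<bullet> x"
    using linear_in_nonbasic[OF basis z1, of p] by (simp add: x_def basic_point_def)
  moreover have "numer F (basic_point A b cs B0) - t * denom F (basic_point A b cs B0) = 0"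
    using B0 denom_pos[OF B0(1)] by (auto simp: val_def field_simps)
  ultimately have "t * denom F x \<le> numer F x"
    using gap[of x] gap[of "basic_point A b cs B0"] by simp
  moreover have "numer F x \<le> t * denom F x"
    using t_max[of "val F x"] B denom_pos[OF B(1)]
    by (auto simp: vals_def x_def val_def field_simps)
  ultimately have numer_x: "numer F x = t * denom F x"
    by simp
  have red_p: "reduced A cs B p j = reduced A cs B (num F) j - t * reduced A cs B (den F) j" for j
  proof -
    have ext: "extend0 p v = extend0 (num F) v - t * extend0 (den F) v" for v :: "('n, 'm) var"
      by (cases v) (simp_all add: p_def)
    have "(\<Sum>v\<in>B. extend0 p v * tableau A cs B v j)
        = (\<Sum>v\<in>B. extend0 (num F) v * tableau A cs B v j)
          - t * (\<Sum>v\<in>B. extend0 (den F) v * tableau A cs B v j)"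
      unfolding ext by (simp only: left_diff_distrib sum_subtractf mult.assoc sum_distrib_left[symmetric])
    then show ?thesis
      by (simp add: reduced_def ext right_diff_distrib)
  qed
  have "reduced_gradient A b cs B F j \<le> 0" if "j \<in> vars cs - B" for j
  proof -
    have "reduced_gradient A b cs B F j = denom F x * reduced A cs B p j"
      by (simp add: reduced_gradient_def x_def[symmetric] numer_x red_p algebra_simps)
    moreover have "reduced A cs B p j \<le> 0"
      using B(2) that by (simp add: opt_def reduced_eq)
    ultimately show ?thesis
      using denom_pos[OF B(1)] by (simp add: x_def mult_nonneg_nonpos)
  qed
  then have "optimal_basis A b F cs B"
    using B by (simp add: optimal_basis_def FB_def)
  then show ?thesis ..
qed

section \<open>The effect of branching and cuts on node domains\<close>

lemma sum_vars_indicator: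
  fixes cs :: "('n::finite, 'm::finite) node"
  assumes "H \<subseteq> vars cs"
  shows "(\<Sum>v\<in>vars cs. (if v \<in> H then 1 else 0) * z v) = (\<Sum>v\<in>H. z v :: real)"
  using assms by (intro sum.mono_neutral_cong_right) auto

lemma node_dom_snoc:
  fixes cs :: "('n::finite, 'm::finite) node"
  assumes "admissible cs"
  shows "x \<in> node_dom A b (cs @ [c]) \<longleftrightarrow>
    (\<exists>z. std_feasible A b cs z \<and> orig_part z = x \<and>
       0 \<le> slack_sign c * (rhs c - (\<Sum>v\<in>vars cs. lhs c v * z v)))"
proof
  assume "x \<in> node_dom A b (cs @ [c])"
  then obtain z where z: "std_feasible A b (cs @ [c]) z" "orig_part z = x"
    by (auto simp: node_dom_def)
  then have "0 \<le> z (Slack (Added (length cs)))"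
    "rhs c - (\<Sum>v\<in>vars cs. lhs c v * z v) = slack_sign c * z (Slack (Added (length cs)))"
    by (auto simp: std_feasible_snoc[OF assms])
  with z show "\<exists>z. std_feasible A b cs z \<and> orig_part z = x \<and>
       0 \<le> slack_sign c * (rhs c - (\<Sum>v\<in>vars cs. lhs c v * z v))"
    using slack_sign_cases[of c] by (intro exI[of _ z]) (auto simp: std_feasible_snoc[OF assms])
next
  assume "\<exists>z. std_feasible A b cs z \<and> orig_part z = x \<and>
       0 \<le> slack_sign c * (rhs c - (\<Sum>v\<in>vars cs. lhs c v * z v))"
  then obtain z z' where "orig_part z = x" "std_feasible A b (cs @ [c]) z'" "\<And>v. v \<in> vars cs \<Longrightarrow> z' v = z v"
    using std_feasible_extend[OF assms] by metis
  then show "x \<in> node_dom A b (cs @ [c])"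
    using orig_part_cong[of cs z' z] unfolding node_dom_def by (metis image_eqI mem_Collect_eq)
qed

lemma sum_vars_Orig:
  fixes cs :: "('n::finite, 'm::finite) node"
  shows "(\<Sum>v\<in>vars cs. (if v = Orig r then 1 else 0) * z v) = orig_part z $ r"
  using sum_vars_indicator[of "{Orig r}" cs z] Orig_in_vars[of r cs] by (simp add: orig_part_def)

lemma node_dom_branch_le:
  fixes cs :: "('n::finite, 'm::finite) node"
  assumes "admissible cs"
  shows "node_dom A b (cs @ [branch_le r t]) = {x \<in> node_dom A b cs. x $ r \<le> of_int \<lfloor>t\<rfloor>}"
  by (auto simp: set_eq_iff node_dom_snoc[OF assms] branch_le_def sum_vars_Orig) (auto simp: node_dom_def)

lemma node_dom_branch_ge:
  fixes cs :: "('n::finite, 'm::finite) node"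
  assumes "admissible cs"
  shows "node_dom A b (cs @ [branch_ge r t]) = {x \<in> node_dom A b cs. of_int \<lceil>t\<rceil> \<le> x $ r}"
  by (auto simp: set_eq_iff node_dom_snoc[OF assms] branch_ge_def sum_vars_Orig) (auto simp: node_dom_def)

lemma admissible_branch:
  "admissible cs \<Longrightarrow> admissible (cs @ [branch_le r t])"
  "admissible cs \<Longrightarrow> admissible (cs @ [branch_ge r t])"
  by (rule admissible.snoc; auto simp: branch_le_def branch_ge_def Orig_in_vars split: if_splits)+

lemma admissible_cut: "admissible cs \<Longrightarrow> H \<subseteq> vars cs \<Longrightarrow> admissible (cs @ [cut H])"
  by (rule admissible.snoc) (auto simp: cut_def split: if_splits)

lemma admissible_cuts:
  assumes "admissible cs" "H \<subseteq> vars cs" "H' \<subseteq> vars cs"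
  shows "admissible (cs @ [cut H, cut H'])"
  using admissible_cut[OF admissible_cut[OF assms(1,2)], of H'] assms(3) by (auto simp: vars_snoc)

lemma node_dom_cuts:
  fixes cs :: "('n::finite, 'm::finite) node"
  assumes "admissible cs" "H \<subseteq> vars cs" "H' \<subseteq> vars cs"
  shows "x \<in> node_dom A b (cs @ [cut H, cut H']) \<longleftrightarrow>
    (\<exists>z. std_feasible A b cs z \<and> orig_part z = x \<and> 1 \<le> (\<Sum>v\<in>H. z v) \<and> 1 \<le> (\<Sum>v\<in>H'. z v))"
    (is "?L \<longleftrightarrow> ?R")
proof -
  let ?cs = "cs @ [cut H]"
  have adm: "admissible ?cs"
    by (rule admissible_cut[OF assms(1,2)])
  have H': "H' \<subseteq> vars ?cs"
    using assms(3) by (auto simp: vars_snoc)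
  have L: "?L \<longleftrightarrow> (\<exists>z. std_feasible A b ?cs z \<and> orig_part z = x \<and> 1 \<le> (\<Sum>v\<in>H'. z v))"
    using node_dom_snoc[OF adm, of x A b "cut H'"] sum_vars_indicator[OF H'] by (simp add: cut_def)
  show ?thesis
  proof
    assume ?L
    then obtain z where "std_feasible A b ?cs z" "orig_part z = x" "1 \<le> (\<Sum>v\<in>H'. z v)"
      using L by blast
    then show ?R
      using std_feasible_snoc[OF assms(1), of A b "cut H" z] sum_vars_indicator[OF assms(2)]
      by (intro exI[of _ z]) (auto simp: cut_def)
  next
    assume ?R
    then obtain z where z: "std_feasible A b cs z" "orig_part z = x" "1 \<le> (\<Sum>v\<in>H. z v)" "1 \<le> (\<Sum>v\<in>H'. z v)"
      by blast
    then obtain z' where z': "std_feasible A b ?cs z'" "\<And>v. v \<in> vars cs \<Longrightarrow> z' v = z v"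
      using std_feasible_extend[OF assms(1) z(1), of "cut H"] sum_vars_indicator[OF assms(2)]
      by (auto simp: cut_def)
    have "orig_part z' = x"
      using orig_part_cong[of cs z' z] z z' by simp
    moreover have "(\<Sum>v\<in>H'. z' v) = (\<Sum>v\<in>H'. z v)"
      using z'(2) assms(3) by (intro sum.cong) auto
    ultimately show ?L
      using L z z' by auto
  qed
qed

section \<open>Termination\<close>

text \<open>
  All feasible points of the node above \<open>x*\<close> are the basic solution itself, so the variables
  in \<open>H\<close> vanish there and cannot have sum \<open>1\<close> or more.
\<close>

lemma basic_point_cut_off:
  fixes cs :: "('n::finite, 'm::finite) node"
  assumes adm: "admissible cs" and B: "is_basis A cs B" "\<forall>v\<in>B. 0 \<le> basic_sol A b cs B v"
    and H: "H \<subseteq> vars cs - B" "H' \<subseteq> vars cs"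
  shows "basic_point A b cs B \<notin> node_dom A b (cs @ [cut H, cut H'])"
proof
  assume "basic_point A b cs B \<in> node_dom A b (cs @ [cut H, cut H'])"
  then obtain z where z: "std_feasible A b cs z" "orig_part z = orig_part (basic_sol A b cs B)"
    "1 \<le> (\<Sum>v\<in>H. z v)"
    unfolding node_dom_cuts[OF adm subset_trans[OF H(1) Diff_subset] H(2)] basic_point_def by blast
  have "z v = basic_sol A b cs B v" if "v \<in> vars cs" for v
    using slacks_unique[OF adm _ _ z(2)] z(1) std_feasible_basic_sol[OF B] that
    by (auto simp: std_feasible_iff)
  then have "z v = 0" if "v \<in> H" for v
    using that H(1) by (auto simp: basic_sol_def)
  then show False
    using z(3) by simp
qed

definition straddled ::
  "real ^ 'n ^ 'm::finite \<Rightarrow> real ^ 'm \<Rightarrow> ('n::finite, 'm) node \<Rightarrow> ('n \<times> int) set" where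
  "straddled A b cs = {(r, t). \<exists>x\<in>node_dom A b cs. of_int t < x $ r \<and> x $ r < of_int t + 1}"

definition node_measure ::
  "real ^ 'n ^ 'm::finite \<Rightarrow> real ^ 'm \<Rightarrow> ('n::finite, 'm) node \<Rightarrow> nat" where
  "node_measure A b cs = card (straddled A b cs) + card {x \<in> node_dom A b cs. integer_point x}"

lemma finite_straddled:
  assumes "bounded (polyh A b)"
  shows "finite (straddled A b cs)"
proof -
  obtain C where C: "\<And>x. x \<in> polyh A b \<Longrightarrow> norm x \<le> C"
    using assms by (auto simp: bounded_iff)
  have "straddled A b cs \<subseteq> UNIV \<times> {\<lfloor>- C\<rfloor> - 1..\<lceil>C\<rceil>}"
  proof (clarsimp simp: straddled_def)
    fix r t x
    assume x: "x \<in> node_dom A b cs" and t: "of_int t < x $ r" "x $ r < of_int t + 1"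
    have "\<bar>x $ r\<bar> \<le> C"
      using x C node_dom_subset_polyh component_le_norm_cart order_trans by (metis subsetD)
    then show "\<lfloor>- C\<rfloor> - 1 \<le> t \<and> t \<le> \<lceil>C\<rceil>"
      using t by linarith
  qed
  then show ?thesis
    by (rule finite_subset) simp
qed

lemma finite_integer_points:
  assumes "bounded S"
  shows "finite {x \<in> S. integer_point (x :: real ^ 'n::finite)}"
proof -
  obtain C where C: "\<And>x. x \<in> S \<Longrightarrow> norm x \<le> C"
    using assms by (auto simp: bounded_iff)
  \<comment> \<open>Integer points are the images of integer vectors in a box.\<close>
  define G where "G = PiE (UNIV :: 'n set) (\<lambda>_. {\<lfloor>- C\<rfloor>..\<lceil>C\<rceil>})"
  have "x \<in> (\<lambda>g. \<chi> j. of_int (g j)) ` G" if "x \<in> S" "integer_point x" for x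
  proof
    show "x = (\<chi> j. of_int ((\<lambda>j. \<lfloor>x $ j\<rfloor>) j))"
      using that(2) by (simp add: vec_eq_iff integer_point_def)
    have "\<bar>x $ j\<bar> \<le> C" for j
      using C[OF that(1)] component_le_norm_cart order_trans by metis
    then have "\<lfloor>- C\<rfloor> \<le> \<lfloor>x $ j\<rfloor> \<and> \<lfloor>x $ j\<rfloor> \<le> \<lceil>C\<rceil>" for j
      by (smt (verit, ccfv_SIG) abs_le_iff floor_mono floor_le_ceiling minus_le_iff le_of_int_ceiling floor_le_iff)
    then show "(\<lambda>j. \<lfloor>x $ j\<rfloor>) \<in> G"
      by (simp add: G_def PiE_UNIV_domain)
  qed
  then have "{x \<in> S. integer_point x} \<subseteq> (\<lambda>g. \<chi> j. of_int (g j)) ` G"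
    by auto
  moreover have "finite G"
    unfolding G_def by (intro finite_PiE) auto
  ultimately show ?thesis
    by (rule finite_subset[OF _ finite_imageI])
qed

lemma straddled_mono: "node_dom A b cs' \<subseteq> node_dom A b cs \<Longrightarrow> straddled A b cs' \<subseteq> straddled A b cs"
  by (auto simp: straddled_def)

text \<open>
  Both summands of the measure are monotone in the domain, so losing a single straddled pair or a
  single integer point suffices.
\<close>

lemma node_measure_less:
  assumes bdd: "bounded (polyh A b)" and sub: "node_dom A b cs' \<subseteq> node_dom A b cs"
    and lost: "straddled A b cs' \<noteq> straddled A b cs \<or>
      (\<exists>x\<in>node_dom A b cs. integer_point x \<and> x \<notin> node_dom A b cs')"
  shows "node_measure A b cs' < node_measure A b cs"
proof -
  let ?I = "\<lambda>cs. {x \<in> node_dom A b cs. integer_point x}"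
  have fin: "finite (?I cs)"
    using bounded_subset[OF bdd node_dom_subset_polyh] by (rule finite_integer_points)
  have I: "?I cs' \<subseteq> ?I cs"
    using sub by auto
  note S = straddled_mono[OF sub]
  have le: "card (straddled A b cs') \<le> card (straddled A b cs)" "card (?I cs') \<le> card (?I cs)"
    using card_mono[OF finite_straddled[OF bdd] S] card_mono[OF fin I] by auto
  from lost show ?thesis
  proof
    assume "straddled A b cs' \<noteq> straddled A b cs"
    then have "card (straddled A b cs') < card (straddled A b cs)"
      using S by (intro psubset_card_mono finite_straddled[OF bdd]) auto
    then show ?thesis
      using le by (simp add: node_measure_def)
  next
    assume "\<exists>x\<in>node_dom A b cs. integer_point x \<and> x \<notin> node_dom A b cs'"
    then have "card (?I cs') < card (?I cs)"
      using I by (intro psubset_card_mono[OF fin]) auto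
    then show ?thesis
      using le by (simp add: node_measure_def)
  qed
qed

text \<open>
  The pair that is lost is the coordinate \<open>r\<close> with the unit interval around \<open>x $ r\<close>: branching
  excludes exactly the interior of this interval.
\<close>

lemma node_measure_branch:
  fixes cs :: "('n::finite, 'm::finite) node"
  assumes adm: "admissible cs" and bdd: "bounded (polyh A b)"
    and x: "x \<in> node_dom A b cs" "x $ r \<notin> \<int>"
  shows "node_measure A b (cs @ [branch_le r (x $ r)]) < node_measure A b cs"
    and "node_measure A b (cs @ [branch_ge r (x $ r)]) < node_measure A b cs"
proof -
  have frac: "of_int \<lfloor>x $ r\<rfloor> < x $ r" "x $ r < of_int \<lfloor>x $ r\<rfloor> + 1"
    using x(2) by (metis Ints_of_int floor_less_iff less_le of_int_floor_le, linarith)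
  have ceil: "\<lceil>x $ r\<rceil> = \<lfloor>x $ r\<rfloor> + 1"
    using frac by linarith
  have "(r, \<lfloor>x $ r\<rfloor>) \<in> straddled A b cs"
    using x frac by (auto simp: straddled_def)
  moreover have "(r, \<lfloor>x $ r\<rfloor>) \<notin> straddled A b (cs @ [branch_le r (x $ r)])"
    "(r, \<lfloor>x $ r\<rfloor>) \<notin> straddled A b (cs @ [branch_ge r (x $ r)])"
    using ceil by (auto simp: straddled_def node_dom_branch_le[OF adm] node_dom_branch_ge[OF adm])
  ultimately show "node_measure A b (cs @ [branch_le r (x $ r)]) < node_measure A b cs"
    "node_measure A b (cs @ [branch_ge r (x $ r)]) < node_measure A b cs"
    using node_dom_branch_le[OF adm, of A b] node_dom_branch_ge[OF adm, of A b]
    by (auto intro!: node_measure_less[OF bdd])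
qed

lemma cut_set_subset: "cut_set A b Z cs B \<subseteq> vars cs - B" "cut_set' A b f cs B \<subseteq> vars cs - B"
  by (auto simp: cut_set_def cut_set'_def)

lemma node_measure_cut:
  fixes cs :: "('n::finite, 'm::finite) node"
  assumes adm: "admissible cs" and bdd: "bounded (polyh A b)"
    and opt: "optimal_basis A b F cs B" and int: "integer_point (basic_point A b cs B)"
    and H: "H \<subseteq> vars cs - B" "H' \<subseteq> vars cs - B"
  shows "node_measure A b (cs @ [cut H, cut H']) < node_measure A b cs"
proof (rule node_measure_less[OF bdd])
  have H': "H \<subseteq> vars cs" "H' \<subseteq> vars cs"
    using H by auto
  show "node_dom A b (cs @ [cut H, cut H']) \<subseteq> node_dom A b cs"
  proof
    fix x assume "x \<in> node_dom A b (cs @ [cut H, cut H'])"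
    then show "x \<in> node_dom A b cs"
      unfolding node_dom_cuts[OF adm H'] unfolding node_dom_def by blast
  qed
  have "basic_point A b cs B \<notin> node_dom A b (cs @ [cut H, cut H'])"
    using opt by (intro basic_point_cut_off[OF adm _ _ H(1) H'(2)]) (auto simp: optimal_basis_def)
  then show "straddled A b (cs @ [cut H, cut H']) \<noteq> straddled A b cs \<or>
      (\<exists>x\<in>node_dom A b cs. integer_point x \<and> x \<notin> node_dom A b (cs @ [cut H, cut H']))"
    using int optimal_basis_basic_point(2)[OF opt] by blast
qed

text \<open>
  Every case of an iteration replaces one node of the multiset by a (possibly empty) collection of
  nodes of smaller measure.
\<close>

lemma iter_decreasing:
  fixes N :: "('n::finite, 'm::finite) node multiset"
  assumes bdd: "bounded (polyh A b)" and adm: "\<forall>cs\<in>#N. admissible cs"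
    and step: "iter A b Z f (N, S) (N', S')"
  shows "(image_mset (node_measure A b) N', image_mset (node_measure A b) N) \<in> mult less_than
    \<and> (\<forall>cs\<in>#N'. admissible cs)"
proof -
  have replace: "(image_mset (node_measure A b) (M + K), image_mset (node_measure A b) (add_mset cs M)) \<in> mult less_than
    \<and> (\<forall>cs\<in>#M + K. admissible cs)"
    if "N = add_mset cs M" "\<And>c. c \<in># K \<Longrightarrow> admissible c \<and> node_measure A b c < node_measure A b cs"
    for cs M K
    using one_step_implies_mult[of "{#node_measure A b cs#}" "image_mset (node_measure A b) K" less_than
        "image_mset (node_measure A b) M"] that adm by auto
  from step show ?thesis
  proof cases
    case (infeasible cs)
    then show ?thesis
      using replace[of cs N' "{#}"] by simp
  next
    case (branch cs B x r M)
    have x: "x \<in> node_dom A b cs"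
      using branch optimal_basis_basic_point(2) by blast
    have "admissible cs"
      using branch adm by simp
    then have "admissible c \<and> node_measure A b c < node_measure A b cs"
      if "c \<in># {#cs @ [branch_le r (x $ r)], cs @ [branch_ge r (x $ r)]#}" for c
      using that node_measure_branch[OF \<open>admissible cs\<close> bdd x \<open>x $ r \<notin> \<int>\<close>] admissible_branch
      by auto
    from replace[where K = "{#cs @ [branch_le r (x $ r)], cs @ [branch_ge r (x $ r)]#}", OF branch(1) this]
    show ?thesis
      using branch(1,2) by simp
  next
    case (fathom cs B x)
    then show ?thesis
      using replace[of cs N' "{#}"] by simp
  next
    case (cut cs B x M)
    have "admissible cs"
      using cut adm by simp
    moreover have "node_measure A b (cs @ [cut (cut_set A b Z cs B), cut (cut_set' A b f cs B)])
        < node_measure A b cs"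
      by (intro node_measure_cut[OF \<open>admissible cs\<close> bdd _ _ cut_set_subset]) (use cut in simp_all)
    moreover have "admissible (cs @ [cut (cut_set A b Z cs B), cut (cut_set' A b f cs B)])"
      using cut_set_subset by (intro admissible_cuts[OF \<open>admissible cs\<close>]) blast+
    ultimately show ?thesis
      using replace[of cs M "{#cs @ [cut (cut_set A b Z cs B), cut (cut_set' A b f cs B)]#}"] cut
      by simp
  qed
qed

theorem no_infinite_run:
  fixes \<sigma> :: "nat \<Rightarrow> ('n::finite, 'm::finite) bc_state"
  assumes bdd: "bounded (polyh A b)" and init: "\<sigma> 0 = init_state"
    and run: "\<And>t. iter A b Z f (\<sigma> t) (\<sigma> (Suc t))"
  shows False
proof -
  have step: "(\<forall>cs\<in>#fst (\<sigma> t). admissible cs) \<Longrightarrow>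
      (image_mset (node_measure A b) (fst (\<sigma> (Suc t))), image_mset (node_measure A b) (fst (\<sigma> t))) \<in> mult less_than
    \<and> (\<forall>cs\<in>#fst (\<sigma> (Suc t)). admissible cs)" for t
    using iter_decreasing[OF bdd, of "fst (\<sigma> t)" Z f "snd (\<sigma> t)" "fst (\<sigma> (Suc t))" "snd (\<sigma> (Suc t))"] run[of t]
    by simp
  have "\<forall>cs\<in>#fst (\<sigma> t). admissible cs" for t
    by (induction t) (use init step in \<open>auto simp: init_state_def intro: admissible.Nil\<close>)
  then have "\<exists>F. \<forall>t. (F (Suc t), F t) \<in> mult less_than"
    using step by (intro exI[of _ "\<lambda>t. image_mset (node_measure A b) (fst (\<sigma> t))"]) blast
  moreover have "wf (mult less_than)"
    by (intro wf_mult wf_less_than)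
  ultimately show False
    unfolding wf_iff_no_infinite_down_chain by blast
qed

section \<open>Efficient points survive\<close>

lemma val_le_iff:
  "denom F x > 0 \<Longrightarrow> denom F y > 0 \<Longrightarrow> val F x \<le> val F y \<longleftrightarrow> numer F x * denom F y \<le> numer F y * denom F x"
  by (simp add: val_def field_simps)

lemma val_less_iff:
  "denom F x > 0 \<Longrightarrow> denom F y > 0 \<Longrightarrow> val F x < val F y \<longleftrightarrow> numer F x * denom F y < numer F y * denom F x"
  by (simp add: val_def field_simps)

text \<open>
  For \<open>y\<close> feasible in the test program, \<open>w i\<close> equals \<open>(val (Z i) y - val (Z i) x) * denom (Z i) y\<close>.
  Its nonnegativity says that \<open>y\<close> is at least as good as \<open>x\<close> in every objective, so efficiency of
  \<open>x\<close> leaves only \<open>w = 0\<close>.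
\<close>

lemma efficient_max_test:
  assumes x: "x \<in> efficient D Z" and pos: "\<And>i y. y \<in> D \<Longrightarrow> denom (Z i) y > 0"
  shows "is_max_value (test_values D Z x) 0"
proof -
  have xD: "x \<in> D"
    using x by (simp add: efficient_def)
  have row: "(num (Z i) - val (Z i) x *\<^sub>R den (Z i)) \<bullet> y - w = val (Z i) x * den0 (Z i) - num0 (Z i)
      \<longleftrightarrow> w = (val (Z i) y - val (Z i) x) * denom (Z i) y" if "y \<in> D" for i y w
  proof -
    have "val (Z i) y * denom (Z i) y = numer (Z i) y"
      using pos[OF that, of i] by (simp add: val_def)
    then show ?thesis
      by (auto simp: left_diff_distrib inner_diff_left numer_def denom_def algebra_simps)
  qed
  show ?thesis
    unfolding is_max_value_def
  proof (intro conjI ballI)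
    show "0 \<in> test_values D Z x"
      unfolding test_values_def using xD row[OF xD, of _ 0]
      by (intro CollectI exI[of _ "\<lambda>_. 0"] exI[of _ x]) simp
    fix u assume "u \<in> test_values D Z x"
    then obtain w y where y: "y \<in> D" and u: "u = (\<Sum>i\<in>UNIV. w i)" and w: "\<And>i. 0 \<le> w i"
      and "\<And>i. (num (Z i) - val (Z i) x *\<^sub>R den (Z i)) \<bullet> y - w i = val (Z i) x * den0 (Z i) - num0 (Z i)"
      unfolding test_values_def by blast
    then have w_eq: "w i = (val (Z i) y - val (Z i) x) * denom (Z i) y" for i
      using row[OF y] by blast
    have "val (Z i) x \<le> val (Z i) y" for i
      using w[of i] pos[OF y, of i] by (simp add: w_eq zero_le_mult_iff)
    then have "val (Z i) y \<le> val (Z i) x" for i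
      using x y unfolding efficient_def not_less[symmetric] by blast
    then have "w i \<le> 0" for i
      using pos[OF y, of i] by (simp add: w_eq mult_le_0_iff)
    then show "u \<le> 0"
      unfolding u by (simp add: sum_nonpos)
  qed
qed

text \<open>
  Outside \<open>H\<close> every non-basic variable worsens some objective and improves none. If those in \<open>H\<close> are
  zero, then \<open>cross_difference\<close> shows that the basic point is at least as good as the point of \<open>z\<close>
  everywhere, and better somewhere as soon as one non-basic variable is nonzero. Efficiency forces all
  of them to zero. The hypothesis on \<open>H\<close> fits both cut sets, with \<open>G\<close> the corresponding list of
  objectives.
\<close>

lemma efficient_meets_cut:
  fixes cs :: "('n::finite, 'm::finite) node"
  assumes B: "is_basis A cs B" "basic_point A b cs B \<in> D" and z: "std_feasible A b cs z"
    and eff: "orig_part z \<in> efficient D G"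
    and pos: "\<And>i x. x \<in> D \<Longrightarrow> denom (G i) x > 0"
    and H: "\<And>j. j \<in> vars cs - B - H \<Longrightarrow>
      (\<forall>i. reduced_gradient A b cs B (G i) j \<le> 0) \<and> (\<exists>i. reduced_gradient A b cs B (G i) j < 0)"
    and zH: "\<And>j. j \<in> H \<Longrightarrow> z j = 0"
  shows "orig_part z = basic_point A b cs B"
proof -
  let ?x = "orig_part z" and ?y = "basic_point A b cs B"
  have xD: "?x \<in> D"
    using eff by (simp add: efficient_def)
  have nonneg: "0 \<le> z j" if "j \<in> vars cs" for j
    using z that by (simp add: std_feasible_def)
  have term_le: "reduced_gradient A b cs B (G i) j * z j \<le> 0" if "j \<in> vars cs - B" for i j
    using zH[of j] H[of j] nonneg[of j] that by (cases "j \<in> H") (auto intro: mult_nonpos_nonneg)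
  have le: "val (G i) ?x \<le> val (G i) ?y" for i
  proof -
    have "(\<Sum>j\<in>vars cs - B. reduced_gradient A b cs B (G i) j * z j) \<le> 0"
      by (intro sum_nonpos term_le)
    then show ?thesis
      using cross_difference[OF B(1) z, of "G i"] by (simp add: val_le_iff pos xD B(2))
  qed
  have "z j = 0" if j: "j \<in> vars cs - B" for j
  proof (rule ccontr)
    assume "z j \<noteq> 0"
    then have zj: "z j > 0" "j \<notin> H"
      using nonneg[of j] zH j by force+
    then obtain i where "reduced_gradient A b cs B (G i) j < 0"
      using H j by blast
    then have "reduced_gradient A b cs B (G i) j * z j < 0"
      using zj by (simp add: mult_neg_pos)
    then have "(\<Sum>j\<in>vars cs - B. reduced_gradient A b cs B (G i) j * z j) < 0"
      using sum_strict_mono_ex1[of "vars cs - B" "\<lambda>j. reduced_gradient A b cs B (G i) j * z j" "\<lambda>_. 0"]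
        term_le j by auto
    then have "val (G i) ?x < val (G i) ?y"
      using cross_difference[OF B(1) z, of "G i"] by (simp add: val_less_iff pos xD B(2))
    then show False
      using eff le B(2) unfolding efficient_def by blast
  qed
  then have "z v = basic_sol A b cs B v" if "v \<in> vars cs" for v
    using node.basic_solution_unique[OF basis_inv_basis[OF B(1)], of "std_rhs b cs" z v] z that
    by (auto simp: basic_sol_eq node.basic_def std_feasible_iff)
  then show ?thesis
    unfolding basic_point_def by (rule orig_part_cong)
qed

lemma integer_sum_ge_1:
  fixes z :: "'v \<Rightarrow> real"
  assumes "finite H" "\<And>j. j \<in> H \<Longrightarrow> 0 \<le> z j" "\<And>j. j \<in> H \<Longrightarrow> z j \<in> \<int>" "j \<in> H" "z j \<noteq> 0"
  shows "1 \<le> (\<Sum>j\<in>H. z j)"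
proof -
  obtain n where "z j = of_int n"
    using assms(3,4) by (auto elim: Ints_cases)
  then have "1 \<le> z j"
    using assms(2)[OF assms(4)] assms(5) by (simp add: of_int_pos)
  also have "z j \<le> (\<Sum>j\<in>H. z j)"
    using assms by (intro member_le_sum) auto
  finally show ?thesis .
qed

text \<open>
  Both cut sets satisfy the hypothesis of \<open>efficient_meets_cut\<close>: the first by definition, the second
  because optimality of the basis already makes the reduced gradient of \<open>f 1\<close> nonpositive. Hence a
  variable in each cut set is nonzero at \<open>x\<close>, and integrality turns this into a sum of at least \<open>1\<close>.
\<close>

lemma efficient_survives_cuts:
  fixes cs :: "('n::finite, 'm::finite) node"
  assumes adm: "admissible cs" and opt: "optimal_basis A b (f 1) cs B"
    and int: "integer_point (basic_point A b cs B)"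
    and slack: "\<forall>x\<in>int_points A b. \<forall>i. (b - A *v x) $ i \<in> \<int>"
    and pos: "\<And>i x. x \<in> polyh A b \<Longrightarrow> denom (Z i) x > 0" "\<And>s x. x \<in> polyh A b \<Longrightarrow> denom (f s) x > 0"
    and x: "x \<in> efficient (int_points A b) Z" "x \<in> efficient (int_points A b) f"
    and dom: "x \<in> node_dom A b cs" and ne: "x \<noteq> basic_point A b cs B"
  shows "cut_set A b Z cs B \<noteq> {}" "cut_set' A b f cs B \<noteq> {}"
    "x \<in> node_dom A b (cs @ [cut (cut_set A b Z cs B), cut (cut_set' A b f cs B)])"
proof -
  let ?D = "int_points A b" and ?H = "cut_set A b Z cs B" and ?H' = "cut_set' A b f cs B"
  obtain z where z: "std_feasible A b cs z" "orig_part z = x"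
    using dom by (auto simp: node_dom_def)
  have B: "is_basis A cs B" "basic_point A b cs B \<in> ?D"
    using opt int optimal_basis_basic_point(3)[OF opt] by (auto simp: optimal_basis_def int_points_def)
  have xD: "x \<in> ?D"
    using x by (simp add: efficient_def)
  have zint: "\<forall>v\<in>vars cs. z v \<in> \<int>"
    using slacks_integer[OF adm z(1)] xD slack z(2) by (auto simp: int_points_def)
  have large: "1 \<le> (\<Sum>v\<in>H. z v)" if H: "H \<subseteq> vars cs - B" "\<exists>j\<in>H. z j \<noteq> 0" for H
  proof -
    obtain j where "j \<in> H" "z j \<noteq> 0"
      using H by blast
    moreover have "finite H"
      using H(1) by (rule finite_subset) simp
    ultimately show ?thesis
      using H(1) zint z(1) by (intro integer_sum_ge_1[of H z j]) (auto simp: std_feasible_def)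
  qed
  have "\<exists>j\<in>?H. z j \<noteq> 0"
  proof (rule ccontr)
    assume "\<not> (\<exists>j\<in>?H. z j \<noteq> 0)"
    moreover have "(\<forall>i. reduced_gradient A b cs B (Z i) j \<le> 0) \<and> (\<exists>i. reduced_gradient A b cs B (Z i) j < 0)"
      if "j \<in> vars cs - B - ?H" for j
      using that unfolding cut_set_def by (simp add: not_less) (metis less_le)
    ultimately have "orig_part z = basic_point A b cs B"
      using efficient_meets_cut[OF B z(1), of Z ?H] x(1) z(2) pos(1) by (auto simp: int_points_def)
    then show False
      using ne z(2) by simp
  qed
  then have H: "?H \<noteq> {}" "1 \<le> (\<Sum>v\<in>?H. z v)"
    using large[of ?H] cut_set_subset by blast+
  have "\<exists>j\<in>?H'. z j \<noteq> 0"
  proof (rule ccontr)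
    assume "\<not> (\<exists>j\<in>?H'. z j \<noteq> 0)"
    moreover have "(\<forall>s. reduced_gradient A b cs B (f s) j \<le> 0) \<and> (\<exists>s. reduced_gradient A b cs B (f s) j < 0)"
      if "j \<in> vars cs - B - ?H'" for j
    proof -
      have "reduced_gradient A b cs B (f 1) j \<le> 0"
        using opt that by (simp add: optimal_basis_def)
      moreover have "reduced_gradient A b cs B (f 2) j < 0 \<or>
          reduced_gradient A b cs B (f 2) j = 0 \<and> reduced_gradient A b cs B (f 1) j \<noteq> 0"
        using that by (auto simp: cut_set'_def)
      ultimately show ?thesis
        unfolding forall_2 by (metis order.refl less_le)
    qed
    ultimately have "orig_part z = basic_point A b cs B"
      using efficient_meets_cut[OF B z(1), of f ?H'] x(2) z(2) pos(2) by (auto simp: int_points_def)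
    then show False
      using ne z(2) by simp
  qed
  then have H': "?H' \<noteq> {}" "1 \<le> (\<Sum>v\<in>?H'. z v)"
    using large[of ?H'] cut_set_subset by blast+
  have sub: "?H \<subseteq> vars cs" "?H' \<subseteq> vars cs"
    using cut_set_subset by blast+
  show "?H \<noteq> {}" "?H' \<noteq> {}"
    using H H' by auto
  show "x \<in> node_dom A b (cs @ [cut ?H, cut ?H'])"
    unfolding node_dom_cuts[OF adm sub] using z H H' by blast
qed

text \<open>
  A point is covered if it has been found already or can still be found below an open node.
\<close>

definition covers ::
  "real ^ 'n ^ 'm::finite \<Rightarrow> real ^ 'm \<Rightarrow> real ^ 'n \<Rightarrow> ('n::finite, 'm) bc_state \<Rightarrow> bool" where
  "covers A b x st \<longleftrightarrow> x \<in> snd st \<or> (\<exists>cs\<in>#fst st. x \<in> node_dom A b cs)"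

text \<open>
  No integer lies strictly between \<open>\<lfloor>t\<rfloor>\<close> and \<open>\<lceil>t\<rceil>\<close>.
\<close>

lemma integer_point_branch:
  fixes cs :: "('n::finite, 'm::finite) node"
  assumes "admissible cs" "x \<in> node_dom A b cs" "integer_point x"
  shows "x \<in> node_dom A b (cs @ [branch_le r t]) \<or> x \<in> node_dom A b (cs @ [branch_ge r t])"
proof -
  obtain n where n: "x $ r = of_int n"
    using assms(3) by (metis integer_point_def Ints_cases)
  have "n \<le> \<lfloor>t\<rfloor> \<or> \<lceil>t\<rceil> \<le> n"
    by linarith
  then show ?thesis
    using assms n by (simp add: node_dom_branch_le node_dom_branch_ge)
qed

lemma iter_covers:
  fixes N :: "('n::finite, 'm::finite) node multiset"
  assumes adm: "\<forall>cs\<in>#N. admissible cs"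
    and slack: "\<forall>x\<in>int_points A b. \<forall>i. (b - A *v x) $ i \<in> \<int>"
    and pos: "\<And>i x. x \<in> polyh A b \<Longrightarrow> denom (Z i) x > 0" "\<And>s x. x \<in> polyh A b \<Longrightarrow> denom (f s) x > 0"
    and x: "x \<in> efficient (int_points A b) Z" "x \<in> efficient (int_points A b) f"
    and step: "iter A b Z f (N, S) (N', S')" and cov: "covers A b x (N, S)"
  shows "covers A b x (N', S')"
proof -
  let ?D = "int_points A b"
  have xD: "x \<in> ?D"
    using x by (simp add: efficient_def)
  have tests: "passes_tests ?D Z f x"
    using efficient_max_test[OF x(1)] efficient_max_test[OF x(2)] pos
    by (simp add: passes_tests_def int_points_def)
  have upd: "S \<subseteq> update ?D Z f y S" "x \<in> update ?D Z f x S" for y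
    using tests by (auto simp: update_def)
  from step show ?thesis
  proof cases
    case (infeasible cs)
    then show ?thesis
      using cov by (auto simp: covers_def)
  next
    case (branch cs B y r M)
    have "admissible cs"
      using branch adm by simp
    then show ?thesis
      using cov branch integer_point_branch[of cs x A b r "y $ r"] xD
      by (auto simp: covers_def int_points_def)
  next
    case (fathom cs B y)
    have "admissible cs"
      using fathom adm by simp
    have "x = y" if "x \<in> node_dom A b cs"
      using efficient_survives_cuts(1,2)[OF \<open>admissible cs\<close>, of A b f B Z x] fathom slack pos x that by blast
    then show ?thesis
      using cov fathom upd by (auto simp: covers_def)
  next
    case (cut cs B y M)
    have "admissible cs"
      using cut adm by simp
    have "x \<in> node_dom A b (cs @ [cut (cut_set A b Z cs B), cut (cut_set' A b f cs B)])"
      if "x \<in> node_dom A b cs" "x \<noteq> y"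
      using efficient_survives_cuts(3)[OF \<open>admissible cs\<close>, of A b f B Z x] cut slack pos x that by blast
    then show ?thesis
      using cov cut upd by (auto simp: covers_def)
  qed
qed

lemma reachable_admissible:
  fixes N :: "('n::finite, 'm::finite) node multiset"
  assumes bdd: "bounded (polyh A b)" and "(iter A b Z f)\<^sup>*\<^sup>* init_state (N, S)"
  shows "\<forall>cs\<in>#N. admissible cs"
proof -
  have "\<forall>cs\<in>#fst st. admissible cs" if "(iter A b Z f)\<^sup>*\<^sup>* init_state st" for st :: "('n, 'm) bc_state"
    using that
  proof (induction rule: rtranclp_induct)
    case base
    then show ?case by (simp add: init_state_def admissible.Nil)
  next
    case (step st st')
    then show ?case
      using iter_decreasing[OF bdd, of "fst st" Z f "snd st" "fst st'" "snd st'"] by simp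
  qed
  from this[OF assms(2)] show ?thesis by simp
qed

lemma node_dom_root: "node_dom A b [] = polyh A b"
proof
  show "polyh A b \<subseteq> node_dom A b []"
  proof
    fix x assume x: "x \<in> polyh A b"
    define z where "z v = (case v of Orig j \<Rightarrow> x $ j | Slack (Given i) \<Rightarrow> (b - A *v x) $ i | _ \<Rightarrow> 0)" for v
    have [simp]: "orig_part z = x"
      by (simp add: orig_part_def z_def)
    have "(\<Sum>v\<in>vars []. std_mat A [] (Given i) v * z v) = b $ i" for i
      unfolding given_row \<open>orig_part z = x\<close> by (simp add: z_def)
    moreover have "0 \<le> z v" if "v \<in> vars []" for v
      using x that by (auto simp: z_def polyh_def vars_def rows_def)
    ultimately have "std_feasible A b [] z"
      by (auto simp: std_feasible_def rows_def)
    then show "x \<in> node_dom A b []"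
      unfolding node_dom_def using \<open>orig_part z = x\<close> by blast
  qed
qed (rule node_dom_subset_polyh)

section \<open>Progress and the main result\<close>

text \<open>
  Nonemptiness of the domain yields an optimal basis, and its basic point is either an integer point
  or has a fractional coordinate to branch on.
\<close>

lemma iter_exists:
  fixes cs :: "('n::finite, 'm::finite) node"
  assumes "admissible cs" "bounded (polyh A b)" "\<And>x. x \<in> polyh A b \<Longrightarrow> denom (f 1) x > 0"
  shows "\<exists>st. iter A b Z f (add_mset cs N, S) st"
proof (cases "node_dom A b cs = {}")
  case True
  then show ?thesis
    using iter.infeasible by blast
next
  case False
  then obtain B where opt: "optimal_basis A b (f 1) cs B"
    using linfrac_optimal_basis_exists assms by blast
  show ?thesis
  proof (cases "integer_point (basic_point A b cs B)")
    case True
    then show ?thesis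
      using iter.fathom[where A = A and b = b and Z = Z and f = f and cs = cs and B = B and N = N and S = S, OF opt refl]
        iter.cut[where A = A and b = b and Z = Z and f = f and cs = cs and B = B and N = N and S = S, OF opt refl] by blast
  next
    case False
    then show ?thesis
      using iter.branch[where A = A and b = b and Z = Z and f = f and cs = cs and B = B and N = N and S = S, OF opt refl]
      unfolding integer_point_def by blast
  qed
qed

theorem theorem4p3:
  fixes A :: "real ^ 'n::finite ^ 'm::finite"
    and b :: "real ^ 'm"
    and Z :: "'k::finite \<Rightarrow> 'n linfrac"
    and f :: "2 \<Rightarrow> 'n linfrac"
  assumes "polyh A b \<noteq> {}"
    and "bounded (polyh A b)"
    and "int_points A b \<noteq> {}"
    and "CARD('k) \<ge> 2"
    and "\<And>i x. x \<in> polyh A b \<Longrightarrow> denom (Z i) x > 0"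
    and "\<And>s x. x \<in> polyh A b \<Longrightarrow> denom (f s) x > 0"
  shows "(\<nexists>\<sigma>. \<sigma> 0 = init_state \<and> (\<forall>t::nat. iter A b Z f (\<sigma> t) (\<sigma> (Suc t)))) \<and>
         (\<forall>N S. (iter A b Z f)\<^sup>*\<^sup>* init_state (N, S) \<and> N \<noteq> {#}
            \<longrightarrow> (\<exists>st. iter A b Z f (N, S) st)) \<and>
         ((\<forall>x\<in>int_points A b. \<forall>i. (b - A *v x) $ i \<in> \<int>) \<longrightarrow>
            (\<forall>S. (iter A b Z f)\<^sup>*\<^sup>* init_state ({#}, S)
               \<longrightarrow> efficient (int_points A b) Z \<inter> efficient (int_points A b) f \<subseteq> S))"
proof (intro conjI allI impI)
  show "\<nexists>\<sigma>. \<sigma> 0 = init_state \<and> (\<forall>t::nat. iter A b Z f (\<sigma> t) (\<sigma> (Suc t)))"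
    using no_infinite_run[OF assms(2)] by blast
next
  fix N S
  assume "(iter A b Z f)\<^sup>*\<^sup>* init_state (N, S) \<and> N \<noteq> {#}"
  then obtain cs M where "N = add_mset cs M" "admissible cs"
    using reachable_admissible[OF assms(2)] by (metis multiset_cases union_single_eq_member)
  then show "\<exists>st. iter A b Z f (N, S) st"
    using iter_exists[OF _ assms(2), where f = f] assms(6) by blast
next
  fix S
  assume slack: "\<forall>x\<in>int_points A b. \<forall>i. (b - A *v x) $ i \<in> \<int>"
    and run: "(iter A b Z f)\<^sup>*\<^sup>* init_state ({#}, S)"
  show "efficient (int_points A b) Z \<inter> efficient (int_points A b) f \<subseteq> S"
  proof
    fix x assume x: "x \<in> efficient (int_points A b) Z \<inter> efficient (int_points A b) f"
    then have "x \<in> polyh A b"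
      by (simp add: efficient_def int_points_def)
    then have init: "covers A b x init_state"
      by (simp add: covers_def init_state_def node_dom_root)
    have "covers A b x st" if "(iter A b Z f)\<^sup>*\<^sup>* init_state st" for st
      using that
    proof (induction rule: rtranclp_induct)
      case base
      show ?case by (rule init)
    next
      case (step st st')
      have "\<forall>cs\<in>#fst st. admissible cs"
        using reachable_admissible[OF assms(2), of Z f "fst st" "snd st"] step by simp
      then show ?case
        using iter_covers[where A = A and b = b and Z = Z and f = f and N = "fst st" and S = "snd st"
            and N' = "fst st'" and S' = "snd st'",
            OF _ slack assms(5,6)] x step
        by simp
    qed
    from this[OF run] show "x \<in> S"
      by (simp add: covers_def)
  qed
qed

end
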